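(* For every $n\ge 3$ and every triangulation $\mathcal{T}$ of $P_n$ such that some triangle of $\mathcal{T}$ does not contain the vertex $0$, there exists a category with cofibrations $\mathcal{C}$ such that the $2$-Segal map $f_{\mathcal{T}}\colon |iS_n\mathcal{C}|\to\operatorname{holim}_{I\in\mathcal{T}}|iS_I\mathcal{C}|$ of the simplicial space $|iS_\bullet\mathcal{C}|$ is not a weak homotopy equivalence.
   Context: A category with cofibrations is a (small) category $\mathcal{C}$ with a zero object $0$ and a distinguished class of morphisms, the cofibrations (written $\rightarrowtail$), such that: for every object $A$ the map $0\to A$ is a cofibration; every isomorphism is a cofibration; cofibrations are closed under composition; the pushout of a cofibration along any morphism exists and is a cofibration. A cofibration sequence $A\rightarrowtail B\twoheadrightarrow D$ is a cofibration followed by its cokernel, i.e. $D$ is a pushout of $0\leftarrow A\rightarrowtail B$. For a finite nonempty totally ordered set $I$ (e.g. $[n]=\{0<1<\dots<n\}$), $\mathrm{Ar}(I)$ is the poset of pairs $(i,j)$, $i\le j$ in $I$, with $(i,j)\le(i',j')$ iff $i\le i'$ and $j\le j'$. $S_I\mathcal{C}$ is the full subcategory of functors $A\colon \mathrm{Ar}(I)\to\mathcal{C}$, $(i,j)\mapsto A_{i,j}$, with $A_{j,j}=0$ for all $j$ and $A_{i,j}\rightarrowtail A_{i,k}\twoheadrightarrow A_{j,k}$ a cofibration sequence for all $i<j<k$; $S_n\mathcal{C}=S_{[n]}\mathcal{C}$. $iS_I\mathcal{C}$ is the subcategory of $S_I\mathcal{C}$ with all objects and only the isomorphisms as morphisms.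 Precomposition makes $[n]\mapsto iS_n\mathcal{C}$ a simplicial category; $|iS_\bullet\mathcal{C}|$ is the simplicial space obtained by taking geometric realization of the nerve in each level. $P_n$ is the regular $(n+1)$-gon with vertices labeled cyclically $0,1,\dots,n$. A triangulation $\mathcal{T}$ of $P_n$ is a subdivision into triangles with vertices among those of $P_n$; a diagonal is an edge of a triangle that is not an edge of $P_n$. Regard $\mathcal{T}$ as the poset (under inclusion) of vertex sets of its triangles and diagonals. The restriction maps $X_n\to X_I$ for $I\subseteq[n]$ (where $X_I\cong X_{|I|-1}$) induce the $2$-Segal map $f_{\mathcal{T}}\colon X_n\to\operatorname{holim}_{I\in\mathcal{T}}X_I$ of a simplicial space $X$; the target is the iterated homotopy fiber product of the $X_T$ ($T$ a triangle) over the $X_e$ ($e$ a diagonal). *)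

theory Defs
  imports "HOL-Analysis.Analysis" "HOL-Homology.Simplices"
begin

section \<open>Categories with cofibrations\<close>

record ('o, 'm) precategory =
  Obj :: "'o set"
  Arr :: "'m set"
  Dom :: "'m \<Rightarrow> 'o"
  Cod :: "'m \<Rightarrow> 'o"
  Idt :: "'o \<Rightarrow> 'm"
  Cmp :: "'m \<Rightarrow> 'm \<Rightarrow> 'm"  \<comment> \<open>\<open>Cmp C g f\<close> is \<open>g\<close> after \<open>f\<close>\<close>

definition Hom :: "('o, 'm, 'x) precategory_scheme \<Rightarrow> 'o \<Rightarrow> 'o \<Rightarrow> 'm set" where
  "Hom C a b = {f \<in> Arr C. Dom C f = a \<and> Cod C f = b}"

locale category =
  fixes C :: "('o, 'm, 'x) precategory_scheme"
  assumes Dom_in: "f \<in> Arr C \<Longrightarrow> Dom C f \<in> Obj C"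
    and Cod_in: "f \<in> Arr C \<Longrightarrow> Cod C f \<in> Obj C"
    and Idt_in: "a \<in> Obj C \<Longrightarrow> Idt C a \<in> Hom C a a"
    and Cmp_in: "\<lbrakk>f \<in> Hom C a b; g \<in> Hom C b c\<rbrakk> \<Longrightarrow> Cmp C g f \<in> Hom C a c"
    and Cmp_Idt: "f \<in> Hom C a b \<Longrightarrow> Cmp C f (Idt C a) = f"
    and Idt_Cmp: "f \<in> Hom C a b \<Longrightarrow> Cmp C (Idt C b) f = f"
    and Cmp_assoc: "\<lbrakk>f \<in> Hom C a b; g \<in> Hom C b c; h \<in> Hom C c d\<rbrakk>
      \<Longrightarrow> Cmp C h (Cmp C g f) = Cmp C (Cmp C h g) f"

definition is_iso :: "('o, 'm, 'x) precategory_scheme \<Rightarrow> 'm \<Rightarrow> bool" where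
  "is_iso C f \<longleftrightarrow> f \<in> Arr C \<and>
    (\<exists>g \<in> Hom C (Cod C f) (Dom C f).
       Cmp C g f = Idt C (Dom C f) \<and> Cmp C f g = Idt C (Cod C f))"

definition is_zero_object :: "('o, 'm, 'x) precategory_scheme \<Rightarrow> 'o \<Rightarrow> bool" where
  "is_zero_object C z \<longleftrightarrow> z \<in> Obj C \<and>
    (\<forall>a \<in> Obj C. (\<exists>!f. f \<in> Hom C z a) \<and> (\<exists>!f. f \<in> Hom C a z))"

text \<open>The square with legs \<open>f : a \<rightarrow> b\<close>, \<open>g : a \<rightarrow> c\<close> and \<open>h : b \<rightarrow> p\<close>, \<open>k : c \<rightarrow> p\<close>
  is a pushout.\<close>

definition is_pushout ::
  "('o, 'm, 'x) precategory_scheme \<Rightarrow> 'm \<Rightarrow> 'm \<Rightarrow> 'm \<Rightarrow> 'm \<Rightarrow> bool" where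
  "is_pushout C f g h k \<longleftrightarrow>
    (\<exists>a b c p. f \<in> Hom C a b \<and> g \<in> Hom C a c \<and> h \<in> Hom C b p \<and> k \<in> Hom C c p \<and>
       Cmp C h f = Cmp C k g \<and>
       (\<forall>q. \<forall>u \<in> Hom C b q. \<forall>v \<in> Hom C c q. Cmp C u f = Cmp C v g \<longrightarrow>
          (\<exists>!w. w \<in> Hom C p q \<and> Cmp C w h = u \<and> Cmp C w k = v)))"

record ('o, 'm) cof_category = "('o, 'm) precategory" +
  Zero :: 'o
  Cof :: "'m set"

locale category_with_cofibrations = category C
  for C :: "('o, 'm, 'x) cof_category_scheme" +
  assumes Zero_zero: "is_zero_object C (Zero C)"
    and Cof_Arr: "Cof C \<subseteq> Arr C"
    and Cof_from_Zero: "\<lbrakk>a \<in> Obj C; f \<in> Hom C (Zero C) a\<rbrakk> \<Longrightarrow> f \<in> Cof C"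
    and Cof_iso: "is_iso C f \<Longrightarrow> f \<in> Cof C"
    and Cof_Cmp: "\<lbrakk>f \<in> Cof C; g \<in> Cof C; Cod C f = Dom C g\<rbrakk> \<Longrightarrow> Cmp C g f \<in> Cof C"
    and Cof_pushout: "\<lbrakk>f \<in> Cof C; g \<in> Arr C; Dom C g = Dom C f\<rbrakk>
      \<Longrightarrow> \<exists>h k. is_pushout C f g h k \<and> k \<in> Cof C"

definition cofibration_sequence ::
  "('o, 'm, 'x) cof_category_scheme \<Rightarrow> 'm \<Rightarrow> 'm \<Rightarrow> bool" where
  "cofibration_sequence C f g \<longleftrightarrow> f \<in> Cof C \<and>
    (\<exists>u \<in> Hom C (Dom C f) (Zero C). \<exists>v \<in> Hom C (Zero C) (Cod C g). is_pushout C f u g v)"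


section \<open>Functors and natural transformations\<close>

text \<open>Functors and the components of natural transformations are extensional, so that
  equality in HOL is equality of functors and of natural transformations.\<close>

record ('o, 'm, 'p, 'q) prefunctor =
  OMap :: "'o \<Rightarrow> 'p"
  MMap :: "'m \<Rightarrow> 'q"

definition is_functor ::
  "('o, 'm, 'x) precategory_scheme \<Rightarrow> ('p, 'q, 'y) precategory_scheme \<Rightarrow>
    ('o, 'm, 'p, 'q) prefunctor \<Rightarrow> bool" where
  "is_functor D C F \<longleftrightarrow>
    OMap F \<in> Obj D \<rightarrow>\<^sub>E Obj C \<and> MMap F \<in> Arr D \<rightarrow>\<^sub>E Arr C \<and>
    (\<forall>f \<in> Arr D. MMap F f \<in> Hom C (OMap F (Dom D f)) (OMap F (Cod D f))) \<and>
    (\<forall>a \<in> Obj D. MMap F (Idt D a) = Idt C (OMap F a)) \<and>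
    (\<forall>f \<in> Arr D. \<forall>g \<in> Arr D. Cod D f = Dom D g \<longrightarrow>
       MMap F (Cmp D g f) = Cmp C (MMap F g) (MMap F f))"

text \<open>The composite of \<open>F : D \<rightarrow> D'\<close> and \<open>G\<close>; the domain \<open>D\<close> is needed for extensionality.\<close>

definition functor_comp ::
  "('o, 'm, 'x) precategory_scheme \<Rightarrow> ('p, 'q, 'r, 's) prefunctor \<Rightarrow>
    ('o, 'm, 'p, 'q) prefunctor \<Rightarrow> ('o, 'm, 'r, 's) prefunctor" where
  "functor_comp D G F =
    \<lparr>OMap = (\<lambda>a \<in> Obj D. OMap G (OMap F a)), MMap = (\<lambda>f \<in> Arr D. MMap G (MMap F f))\<rparr>"

definition functor_category ::
  "('o, 'm, 'x) precategory_scheme \<Rightarrow> ('p, 'q, 'y) precategory_scheme \<Rightarrow>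
    (('o, 'm, 'p, 'q) prefunctor,
     ('o, 'm, 'p, 'q) prefunctor \<times> ('o, 'm, 'p, 'q) prefunctor \<times> ('o \<Rightarrow> 'q)) precategory" where
  "functor_category D C =
    \<lparr>Obj = {F. is_functor D C F},
     Arr = {(F, G, \<eta>). is_functor D C F \<and> is_functor D C G \<and> \<eta> \<in> extensional (Obj D) \<and>
              (\<forall>a \<in> Obj D. \<eta> a \<in> Hom C (OMap F a) (OMap G a)) \<and>
              (\<forall>f \<in> Arr D. Cmp C (MMap G f) (\<eta> (Dom D f)) = Cmp C (\<eta> (Cod D f)) (MMap F f))},
     Dom = (\<lambda>(F, G, \<eta>). F),
     Cod = (\<lambda>(F, G, \<eta>). G),
     Idt = (\<lambda>F. (F, F, \<lambda>a \<in> Obj D. Idt C (OMap F a))),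
     Cmp = (\<lambda>(G, H, \<theta>) (F, G', \<eta>). (F, H, \<lambda>a \<in> Obj D. Cmp C (\<theta> a) (\<eta> a)))\<rparr>"

text \<open>Precomposition with \<open>F : D' \<rightarrow> D\<close>, on a subcategory \<open>E\<close> of a functor category with
  source \<open>D\<close>.\<close>

definition precomp_functor where
  "precomp_functor D' E F =
    \<lparr>OMap = (\<lambda>G \<in> Obj E. functor_comp D' G F),
     MMap = (\<lambda>(G, H, \<eta>) \<in> Arr E.
       (functor_comp D' G F, functor_comp D' H F, \<lambda>a \<in> Obj D'. \<eta> (OMap F a)))\<rparr>"

definition full_subcategory ::
  "('o, 'm) precategory \<Rightarrow> ('o \<Rightarrow> bool) \<Rightarrow> ('o, 'm) precategory" where
  "full_subcategory C P =
    C\<lparr>Obj := {a \<in> Obj C. P a}, Arr := {f \<in> Arr C. P (Dom C f) \<and> P (Cod C f)}\<rparr>"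

definition core :: "('o, 'm) precategory \<Rightarrow> ('o, 'm) precategory" where
  "core C = C\<lparr>Arr := {f \<in> Arr C. is_iso C f}\<rparr>"

definition poset_category :: "'a set \<Rightarrow> ('a \<Rightarrow> 'a \<Rightarrow> bool) \<Rightarrow> ('a, 'a \<times> 'a) precategory" where
  "poset_category S r =
    \<lparr>Obj = S, Arr = {(x, y). x \<in> S \<and> y \<in> S \<and> r x y}, Dom = fst, Cod = snd,
     Idt = (\<lambda>x. (x, x)), Cmp = (\<lambda>g f. (fst f, snd g))\<rparr>"

definition poset_functor ::
  "('a, 'a \<times> 'a) precategory \<Rightarrow> ('a \<Rightarrow> 'b) \<Rightarrow> ('a, 'a \<times> 'a, 'b, 'b \<times> 'b) prefunctor" where
  "poset_functor P \<theta> =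
    \<lparr>OMap = restrict \<theta> (Obj P), MMap = restrict (map_prod \<theta> \<theta>) (Arr P)\<rparr>"


section \<open>The construction \<open>S\<^sub>\<bullet>\<close>\<close>

definition Ar :: "nat set \<Rightarrow> (nat \<times> nat, (nat \<times> nat) \<times> (nat \<times> nat)) precategory" where
  "Ar I = poset_category {(i, j). i \<in> I \<and> j \<in> I \<and> i \<le> j} (\<lambda>(i, j) (i', j'). i \<le> i' \<and> j \<le> j')"

type_synonym ('o, 'm) ar_functor =
  "(nat \<times> nat, (nat \<times> nat) \<times> (nat \<times> nat), 'o, 'm) prefunctor"

type_synonym ('o, 'm) ar_transf =
  "('o, 'm) ar_functor \<times> ('o, 'm) ar_functor \<times> (nat \<times> nat \<Rightarrow> 'm)"

definition S_cat ::
  "('o, 'm, 'x) cof_category_scheme \<Rightarrow> nat set \<Rightarrow>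
    (('o, 'm) ar_functor, ('o, 'm) ar_transf) precategory" where
  "S_cat C I = full_subcategory (functor_category (Ar I) C)
     (\<lambda>A. (\<forall>j \<in> I. OMap A (j, j) = Zero C) \<and>
       (\<forall>i \<in> I. \<forall>j \<in> I. \<forall>k \<in> I. i < j \<and> j < k \<longrightarrow>
          cofibration_sequence C (MMap A ((i, j), (i, k))) (MMap A ((i, k), (j, k)))))"

definition iS ::
  "('o, 'm, 'x) cof_category_scheme \<Rightarrow> nat set \<Rightarrow>
    (('o, 'm) ar_functor, ('o, 'm) ar_transf) precategory" where
  "iS C I = core (S_cat C I)"

text \<open>The functor \<open>iS C J \<rightarrow> iS C I\<close> induced by a monotone map \<open>\<theta> : I \<rightarrow> J\<close>.\<close>

definition iS_map ::
  "('o, 'm, 'x) cof_category_scheme \<Rightarrow> nat set \<Rightarrow> nat set \<Rightarrow> (nat \<Rightarrow> nat) \<Rightarrow>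
    (('o, 'm) ar_functor, ('o, 'm) ar_transf, ('o, 'm) ar_functor, ('o, 'm) ar_transf)
      prefunctor" where
  "iS_map C I J \<theta> = precomp_functor (Ar I) (iS C J) (poset_functor (Ar I) (map_prod \<theta> \<theta>))"


section \<open>Nerve and geometric realization\<close>

definition ordinal :: "nat \<Rightarrow> (nat, nat \<times> nat) precategory" where
  "ordinal p = poset_category {..p} (\<le>)"

text \<open>In a simplicial set \<open>X\<close>, a monotone map \<open>\<theta> : [m] \<rightarrow> [n]\<close> acts as
  \<open>Act X m n \<theta> : X\<^sub>n \<rightarrow> X\<^sub>m\<close>.\<close>

record 's simplicial_set =
  Simp :: "nat \<Rightarrow> 's set"
  Act :: "nat \<Rightarrow> nat \<Rightarrow> (nat \<Rightarrow> nat) \<Rightarrow> 's \<Rightarrow> 's"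

definition nerve ::
  "('o, 'm, 'x) precategory_scheme \<Rightarrow> (nat, nat \<times> nat, 'o, 'm) prefunctor simplicial_set" where
  "nerve D =
    \<lparr>Simp = (\<lambda>p. {F. is_functor (ordinal p) D F}),
     Act = (\<lambda>m n \<theta> F. functor_comp (ordinal m) F (poset_functor (ordinal m) \<theta>))\<rparr>"

definition nerve_map ::
  "('o, 'm, 'p, 'q) prefunctor \<Rightarrow> nat \<Rightarrow>
    (nat, nat \<times> nat, 'o, 'm) prefunctor \<Rightarrow> (nat, nat \<times> nat, 'p, 'q) prefunctor" where
  "nerve_map G p F = functor_comp (ordinal p) G F"

definition simplex_topology :: "nat \<Rightarrow> (nat \<Rightarrow> real) topology" where
  "simplex_topology p = subtopology (powertop_real UNIV) (standard_simplex p)"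

definition simplex_push :: "nat \<Rightarrow> (nat \<Rightarrow> nat) \<Rightarrow> (nat \<Rightarrow> real) \<Rightarrow> (nat \<Rightarrow> real)" where
  "simplex_push m \<theta> t = (\<lambda>j. \<Sum>i | i \<le> m \<and> \<theta> i = j. t i)"

definition cells :: "'s simplicial_set \<Rightarrow> (nat \<times> 's \<times> (nat \<Rightarrow> real)) topology" where
  "cells X = sum_topology
    (\<lambda>p. prod_topology (discrete_topology (Simp X p)) (simplex_topology p)) UNIV"

inductive glue ::
  "'s simplicial_set \<Rightarrow> nat \<times> 's \<times> (nat \<Rightarrow> real) \<Rightarrow> nat \<times> 's \<times> (nat \<Rightarrow> real) \<Rightarrow> bool"
  for X where
  "\<lbrakk>monotone_on {..m} (\<le>) (\<le>) \<theta>; \<theta> ` {..m} \<subseteq> {..n}; x \<in> Simp X n; t \<in> standard_simplex m\<rbrakk>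
    \<Longrightarrow> glue X (m, Act X m n \<theta> x, t) (n, x, simplex_push m \<theta> t)"

text \<open>The point of the realization represented by a point of a cell.\<close>

definition cell_class ::
  "'s simplicial_set \<Rightarrow> nat \<times> 's \<times> (nat \<Rightarrow> real) \<Rightarrow> (nat \<times> 's \<times> (nat \<Rightarrow> real)) set" where
  "cell_class X z = {w. equivclp (glue X) z w}"

definition quotient_topology :: "'a topology \<Rightarrow> ('a \<Rightarrow> 'b) \<Rightarrow> 'b topology" where
  "quotient_topology X q = topology
    (\<lambda>U. U \<subseteq> q ` topspace X \<and> openin X {x \<in> topspace X. q x \<in> U})"

definition realization :: "'s simplicial_set \<Rightarrow> (nat \<times> 's \<times> (nat \<Rightarrow> real)) set topology" where
  "realization X = quotient_topology (cells X) (cell_class X)"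

text \<open>The map \<open>|X| \<rightarrow> |Y|\<close> induced by a simplicial map \<open>\<phi>\<close>: the image of a class is the
  (single) class met by the images of its representatives.\<close>

definition realization_map ::
  "'t simplicial_set \<Rightarrow> (nat \<Rightarrow> 's \<Rightarrow> 't) \<Rightarrow>
    (nat \<times> 's \<times> (nat \<Rightarrow> real)) set \<Rightarrow> (nat \<times> 't \<times> (nat \<Rightarrow> real)) set" where
  "realization_map Y \<phi> c = (\<Union>(p, x, t) \<in> c. cell_class Y (p, \<phi> p x, t))"


section \<open>Simplicial spaces\<close>

text \<open>Simplicial spaces are given on all finite nonempty sets of natural numbers with the monotone
  maps between them, not only on the sets \<open>[n] = {..n}\<close>: a monotone map
  \<open>\<theta> : I \<rightarrow> J\<close> acts as \<open>Pull X I J \<theta> : X\<^sub>J \<rightarrow> X\<^sub>I\<close>.\<close>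

record 'a simplicial_space =
  Level :: "nat set \<Rightarrow> 'a topology"
  Pull :: "nat set \<Rightarrow> nat set \<Rightarrow> (nat \<Rightarrow> nat) \<Rightarrow> 'a \<Rightarrow> 'a"

definition restr :: "'a simplicial_space \<Rightarrow> nat set \<Rightarrow> nat set \<Rightarrow> 'a \<Rightarrow> 'a" where
  "restr X J I = Pull X I J (\<lambda>i. i)"

type_synonym ('o, 'm) iS_point =
  "(nat \<times> (nat, nat \<times> nat, ('o, 'm) ar_functor, ('o, 'm) ar_transf) prefunctor \<times>
     (nat \<Rightarrow> real)) set"

definition iS_space ::
  "('o, 'm, 'x) cof_category_scheme \<Rightarrow> ('o, 'm) iS_point simplicial_space" where
  "iS_space C =
    \<lparr>Level = (\<lambda>I. realization (nerve (iS C I))),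
     Pull = (\<lambda>I J \<theta>. realization_map (nerve (iS C I)) (nerve_map (iS_map C I J \<theta>)))\<rparr>"


section \<open>Triangulations of the regular polygon\<close>

definition polygon_vertex :: "nat \<Rightarrow> nat \<Rightarrow> complex" where
  "polygon_vertex n k = cis (2 * pi * real k / real (n + 1))"

definition polygon_hull :: "nat \<Rightarrow> nat set \<Rightarrow> complex set" where
  "polygon_hull n I = convex hull (polygon_vertex n ` I)"

text \<open>A triangulation is given by the vertex sets of its triangles. The library predicate
  \<open>triangulation\<close> says that the pieces are simplices which meet in common faces.\<close>

definition polygon_triangulation :: "nat \<Rightarrow> nat set set \<Rightarrow> bool" where
  "polygon_triangulation n \<T> \<longleftrightarrow>
    (\<forall>I \<in> \<T>. I \<subseteq> {..n} \<and> card I = 3) \<and>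
    triangulation (polygon_hull n ` \<T>) \<and>
    (\<Union>I \<in> \<T>. polygon_hull n I) = polygon_hull n {..n}"

definition polygon_edges :: "nat \<Rightarrow> nat set set" where
  "polygon_edges n = {{k, (k + 1) mod (n + 1)} |k. k \<le> n}"

definition diagonals :: "nat \<Rightarrow> nat set set \<Rightarrow> nat set set" where
  "diagonals n \<T> = {e. card e = 2 \<and> (\<exists>I \<in> \<T>. e \<subseteq> I) \<and> e \<notin> polygon_edges n}"

definition triangulation_poset :: "nat \<Rightarrow> nat set set \<Rightarrow> nat set set" where
  "triangulation_poset n \<T> = \<T> \<union> diagonals n \<T>"


section \<open>The 2-Segal map\<close>

text \<open>Paths in \<open>X\<close>, as extensional functions on \<open>[0,1]\<close>, with the compact-open topology.\<close>

definition path_space :: "'a topology \<Rightarrow> (real \<Rightarrow> 'a) topology" where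
  "path_space X = topology_generated_by
    {{\<gamma> \<in> extensional {0..1}. pathin X \<gamma> \<and> \<gamma> ` K \<subseteq> U} |K U.
       K \<subseteq> {0..1} \<and> compact K \<and> openin X U}"

definition strict_pairs :: "nat set set \<Rightarrow> (nat set \<times> nat set) set" where
  "strict_pairs P = {(I, J). I \<in> P \<and> J \<in> P \<and> J \<subset> I}"

text \<open>The homotopy limit of \<open>I \<mapsto> X\<^sub>I\<close> over a poset \<open>P\<close> of subsets (under inclusion) that
  has no chains of three elements. For such \<open>P\<close> the Bousfield--Kan formula reads as follows: a point
  consists of points \<open>x\<^sub>I \<in> X\<^sub>I\<close> and, for every \<open>J \<subset> I\<close>, a path in \<open>X\<^sub>J\<close> from the restriction of
  \<open>x\<^sub>I\<close> to \<open>x\<^sub>J\<close>. If \<open>P\<close> comes from a triangulation, then for a diagonal \<open>e\<close> between triangles \<open>T\<close>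
  and \<open>T'\<close> the two paths in \<open>X\<^sub>e\<close> form one path between the restrictions of \<open>x\<^sub>T\<close> and \<open>x\<^sub>T\<^sub>'\<close> with
  midpoint \<open>x\<^sub>e\<close>; so this is the iterated homotopy fiber product. Products are not made compactly
  generated; this does not affect homotopy groups.\<close>

definition holim ::
  "nat set set \<Rightarrow> 'a simplicial_space \<Rightarrow>
    ((nat set \<Rightarrow> 'a) \<times> (nat set \<times> nat set \<Rightarrow> real \<Rightarrow> 'a)) topology" where
  "holim P X = subtopology
    (prod_topology (product_topology (Level X) P)
       (product_topology (\<lambda>(I, J). path_space (Level X J)) (strict_pairs P)))
    {(x, \<gamma>). \<forall>(I, J) \<in> strict_pairs P. \<gamma> (I, J) 0 = restr X I J (x I) \<and> \<gamma> (I, J) 1 = x J}"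

definition two_segal_map ::
  "nat \<Rightarrow> nat set set \<Rightarrow> 'a simplicial_space \<Rightarrow> 'a \<Rightarrow>
    (nat set \<Rightarrow> 'a) \<times> (nat set \<times> nat set \<Rightarrow> real \<Rightarrow> 'a)" where
  "two_segal_map n P X x =
    ((\<lambda>I \<in> P. restr X {..n} I x), (\<lambda>(I, J) \<in> strict_pairs P. \<lambda>s \<in> {0..1}. restr X {..n} J x))"


section \<open>Weak homotopy equivalences\<close>

definition cube :: "nat \<Rightarrow> (nat \<Rightarrow> real) topology" where
  "cube k = product_topology (\<lambda>_. top_of_set {0..1}) {..<k}"

definition cube_boundary :: "nat \<Rightarrow> (nat \<Rightarrow> real) set" where
  "cube_boundary k = {t \<in> topspace (cube k). \<exists>i<k. t i = 0 \<or> t i = 1}"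

definition spheroids :: "nat \<Rightarrow> 'a topology \<Rightarrow> 'a \<Rightarrow> ((nat \<Rightarrow> real) \<Rightarrow> 'a) set" where
  "spheroids k X a = {f. continuous_map (cube k) X f \<and> f ` cube_boundary k \<subseteq> {a}}"

definition spheroid_class ::
  "nat \<Rightarrow> 'a topology \<Rightarrow> 'a \<Rightarrow> ((nat \<Rightarrow> real) \<Rightarrow> 'a) \<Rightarrow> ((nat \<Rightarrow> real) \<Rightarrow> 'a) set" where
  "spheroid_class k X a f =
    {g. homotopic_with (\<lambda>h. h ` cube_boundary k \<subseteq> {a}) (cube k) X f g}"

definition homotopy_group ::
  "nat \<Rightarrow> 'a topology \<Rightarrow> 'a \<Rightarrow> ((nat \<Rightarrow> real) \<Rightarrow> 'a) set set" where
  "homotopy_group k X a = spheroid_class k X a ` spheroids k X a"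

text \<open>For \<open>k = 0\<close> the path components are used. Continuity of \<open>f\<close> is not part of the definition
  (the 2-Segal map of \<open>iS_space C\<close> is continuous), so that the negation cannot hold for lack of it. The induced maps of homotopy groups are
  homomorphisms, so that they are isomorphisms if and only if they are bijective.\<close>

definition weak_homotopy_equivalence :: "'a topology \<Rightarrow> 'b topology \<Rightarrow> ('a \<Rightarrow> 'b) \<Rightarrow> bool" where
  "weak_homotopy_equivalence X Y f \<longleftrightarrow>
    bij_betw (\<lambda>c. \<Union>x \<in> c. path_component_of_set Y (f x))
      (path_components_of X) (path_components_of Y) \<and>
    (\<forall>k \<ge> 1. \<forall>a \<in> topspace X.
      bij_betw (\<lambda>c. \<Union>p \<in> c. spheroid_class k Y (f a) (f \<circ> p))
        (homotopy_group k X a) (homotopy_group k Y (f a)))"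

end

theory Submission
  imports Defs
begin

text \<open>If all arrows of \<open>C\<close> are cofibrations, a pair of cofibrations \<open>A\<^sub>0\<^sub>1 \<rightarrow> A\<^sub>0\<^sub>3\<close>, \<open>A\<^sub>1\<^sub>2 \<rightarrow> A\<^sub>1\<^sub>3\<close> does
  not determine \<open>A\<^sub>0\<^sub>2\<close>: for \<open>A\<^sub>0\<^sub>1 = a\<close> and \<open>A\<^sub>0\<^sub>3 = 0\<close> both \<open>A\<^sub>0\<^sub>2 = a\<close> and \<open>A\<^sub>0\<^sub>2 = 0\<close> are possible. In
  general let \<open>x\<^sub>m\<close> be the object \<open>a = \<dots> = a \<rightarrow> 0 \<rightarrow> \<dots> \<rightarrow> 0\<close> of \<open>iS\<^sub>n C\<close> with \<open>m\<close> copies of \<open>a\<close>; all its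
  subquotients \<open>A\<^sub>i\<^sub>j\<close> with \<open>0 < i\<close> vanish. If \<open>i < j < k\<close> are the vertices of a triangle that avoids \<open>0\<close>,
  then \<open>x\<^sub>i\<close> and \<open>x\<^sub>j\<close> are not isomorphic, but they differ only on pairs \<open>(0, b)\<close> with \<open>i < b \<le> j\<close>, and
  no triangle contains such a pair, because the chord from \<open>0\<close> to \<open>b\<close> crosses the chord from \<open>i\<close> to
  \<open>k\<close>. So the 2-Segal map sends the vertices \<open>x\<^sub>i\<close> and \<open>x\<^sub>j\<close>, which lie in different path components,
  to the same point.

  For \<open>C\<close> we take the opposite of the category of finite pointed sets, where pushouts are given by
  fibre products.\<close>


section \<open>Categories and functors\<close>

lemma HomD:
  assumes "f \<in> Hom C a b"
  shows "f \<in> Arr C" "Dom C f = a" "Cod C f = b"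
  using assms by (simp_all add: Hom_def)

lemma zero_objectD:
  assumes "is_zero_object C z" "a \<in> Obj C"
  shows "\<exists>f. f \<in> Hom C z a" "\<exists>f. f \<in> Hom C a z"
    and "\<lbrakk>f \<in> Hom C z a; g \<in> Hom C z a\<rbrakk> \<Longrightarrow> f = g"
    and "\<lbrakk>f \<in> Hom C a z; g \<in> Hom C a z\<rbrakk> \<Longrightarrow> f = g"
proof -
  have "\<exists>!f. f \<in> Hom C z a" "\<exists>!f. f \<in> Hom C a z"
    using assms by (simp_all add: is_zero_object_def)
  then show "\<exists>f. f \<in> Hom C z a" "\<exists>f. f \<in> Hom C a z"
    "\<lbrakk>f \<in> Hom C z a; g \<in> Hom C z a\<rbrakk> \<Longrightarrow> f = g" "\<lbrakk>f \<in> Hom C a z; g \<in> Hom C a z\<rbrakk> \<Longrightarrow> f = g"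
    by (auto dest: ex1_implies_ex)
qed

context category
begin

section \<open>Isomorphisms and zero objects\<close>

lemma Hom_Obj:
  assumes "f \<in> Hom C a b"
  shows "a \<in> Obj C" "b \<in> Obj C"
  using assms Dom_in Cod_in by (auto simp: Hom_def)

lemma Arr_Hom: "f \<in> Arr C \<Longrightarrow> f \<in> Hom C (Dom C f) (Cod C f)"
  by (simp add: Hom_def)

lemma is_iso_iff:
  assumes "f \<in> Hom C a b"
  shows "is_iso C f \<longleftrightarrow> (\<exists>g \<in> Hom C b a. Cmp C g f = Idt C a \<and> Cmp C f g = Idt C b)"
  using assms by (auto simp: is_iso_def Hom_def)

lemma is_iso_Idt: "a \<in> Obj C \<Longrightarrow> is_iso C (Idt C a)"
  using is_iso_iff[OF Idt_in] Idt_in Idt_Cmp by blast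

lemma is_iso_Cmp:
  assumes f: "f \<in> Hom C a b" "is_iso C f" and g: "g \<in> Hom C b c" "is_iso C g"
  shows "is_iso C (Cmp C g f)"
proof -
  obtain f' where f': "f' \<in> Hom C b a" "Cmp C f' f = Idt C a" "Cmp C f f' = Idt C b"
    using f is_iso_iff by blast
  obtain g' where g': "g' \<in> Hom C c b" "Cmp C g' g = Idt C b" "Cmp C g g' = Idt C c"
    using g is_iso_iff by blast
  have gf: "Cmp C g f \<in> Hom C a c" and fg: "Cmp C f' g' \<in> Hom C c a"
    using f f' g g' Cmp_in by blast+
  have "Cmp C (Cmp C f' g') (Cmp C g f) = Cmp C f' (Cmp C (Cmp C g' g) f)"
    using Cmp_assoc[OF gf g'(1) f'(1)] Cmp_assoc[OF f(1) g(1) g'(1)] by simp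
  also have "\<dots> = Idt C a" using f f' g' by (simp add: Idt_Cmp)
  finally have 1: "Cmp C (Cmp C f' g') (Cmp C g f) = Idt C a" .
  have "Cmp C (Cmp C g f) (Cmp C f' g') = Cmp C g (Cmp C (Cmp C f f') g')"
    using Cmp_assoc[OF fg f(1) g(1)] Cmp_assoc[OF g'(1) f'(1) f(1)] by simp
  also have "\<dots> = Idt C c" using g f' g' by (simp add: Idt_Cmp)
  finally show ?thesis using 1 fg is_iso_iff[OF gf] by blast
qed

lemma zero_object_iso:
  assumes f: "f \<in> Hom C a b" "is_iso C f" and a: "is_zero_object C a"
  shows "is_zero_object C b"
proof -
  obtain g where g: "g \<in> Hom C b a" "Cmp C g f = Idt C a" "Cmp C f g = Idt C b"
    using f is_iso_iff by blast
  have "\<exists>!h. h \<in> Hom C b c" if c: "c \<in> Obj C" for c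
  proof -
    obtain h where h: "h \<in> Hom C a c" using zero_objectD(1)[OF a c] ..
    show ?thesis
    proof
      show "Cmp C h g \<in> Hom C b c" using g(1) h by (rule Cmp_in)
    next
      fix k assume k: "k \<in> Hom C b c"
      \<comment> \<open>Inserting \<open>f\<close> after \<open>g\<close> as the identity of
        \<open>b\<close> makes \<open>k\<close> factor through \<open>a\<close>, out of which arrows
        are unique.\<close>
      then have "k = Cmp C k (Cmp C f g)" by (simp add: g Cmp_Idt)
      also have "\<dots> = Cmp C (Cmp C k f) g" using g(1) f(1) k by (rule Cmp_assoc)
      also have "Cmp C k f = h" using zero_objectD(3)[OF a c Cmp_in[OF f(1) k] h] .
      finally show "k = Cmp C h g" .
    qed
  qed
  moreover have "\<exists>!h. h \<in> Hom C c b" if c: "c \<in> Obj C" for c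
  proof -
    obtain h where h: "h \<in> Hom C c a" using zero_objectD(2)[OF a c] ..
    show ?thesis
    proof
      show "Cmp C f h \<in> Hom C c b" using h f(1) by (rule Cmp_in)
    next
      fix k assume k: "k \<in> Hom C c b"
      then have "k = Cmp C (Cmp C f g) k" by (simp add: g Idt_Cmp)
      also have "\<dots> = Cmp C f (Cmp C g k)" using k g(1) f(1) by (rule Cmp_assoc[symmetric])
      also have "Cmp C g k = h" using zero_objectD(4)[OF a c Cmp_in[OF k g(1)] h] .
      finally show "k = Cmp C f h" .
    qed
  qed
  ultimately show ?thesis using Hom_Obj(2)[OF f(1)] by (simp add: is_zero_object_def)
qed

text \<open>Being zero is the isomorphism invariant that later separates the two objects of
  \<open>iS C {..n}\<close>. The inverse of \<open>f\<close> gives the reverse implication.\<close>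

lemma zero_object_iso_iff:
  assumes f: "f \<in> Hom C a b" "is_iso C f"
  shows "is_zero_object C a \<longleftrightarrow> is_zero_object C b"
proof -
  obtain g where g: "g \<in> Hom C b a" "Cmp C g f = Idt C a" "Cmp C f g = Idt C b"
    using f is_iso_iff by blast
  then have "is_iso C g" using is_iso_iff f(1) by blast
  then show ?thesis using zero_object_iso f g(1) by blast
qed

end

section \<open>Posets, full subcategories and cores as categories\<close>

lemma poset_category_category:
  assumes "\<And>x. x \<in> S \<Longrightarrow> r x x"
    and "\<And>x y z. \<lbrakk>x \<in> S; y \<in> S; z \<in> S; r x y; r y z\<rbrakk> \<Longrightarrow> r x z"
  shows "category (poset_category S r)"
  by unfold_locales (auto simp: poset_category_def Hom_def intro: assms)

lemma category_Ar: "category (Ar I)"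
  unfolding Ar_def by (rule poset_category_category) auto

lemma category_ordinal: "category (ordinal p)"
  unfolding ordinal_def by (rule poset_category_category) auto

lemma category_full_subcategory:
  assumes "category C"
  shows "category (full_subcategory C P)"
proof -
  interpret category C by fact
  have Hom: "f \<in> Hom (full_subcategory C P) a b \<longleftrightarrow> f \<in> Hom C a b \<and> P a \<and> P b" for f a b
    by (auto simp: full_subcategory_def Hom_def)
  show ?thesis
    by unfold_locales
      (auto simp: Hom, auto simp: full_subcategory_def Dom_in Cod_in Idt_in Cmp_in Cmp_Idt Idt_Cmp
        intro: Cmp_in Cmp_assoc)
qed

lemma category_core:
  assumes "category C"
  shows "category (core C)"
proof -
  interpret category C by fact
  have Hom: "f \<in> Hom (core C) a b \<longleftrightarrow> f \<in> Hom C a b \<and> is_iso C f" for f a b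
    by (auto simp: core_def Hom_def)
  show ?thesis
    by unfold_locales
      (auto simp: Hom, auto simp: core_def Dom_in Cod_in Idt_in is_iso_Idt Cmp_Idt Idt_Cmp
        intro: Cmp_in Cmp_assoc is_iso_Cmp)
qed

section \<open>Functors\<close>

lemma is_functorD:
  assumes "is_functor D C F"
  shows "OMap F \<in> Obj D \<rightarrow>\<^sub>E Obj C" "MMap F \<in> Arr D \<rightarrow>\<^sub>E Arr C"
    and "f \<in> Hom D a b \<Longrightarrow> MMap F f \<in> Hom C (OMap F a) (OMap F b)"
    and "a \<in> Obj D \<Longrightarrow> MMap F (Idt D a) = Idt C (OMap F a)"
    and "\<lbrakk>f \<in> Hom D a b; g \<in> Hom D b c\<rbrakk> \<Longrightarrow> MMap F (Cmp D g f) = Cmp C (MMap F g) (MMap F f)"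
  using assms by (auto simp: is_functor_def Hom_def)

lemma is_functor_Obj: "is_functor D C F \<Longrightarrow> a \<in> Obj D \<Longrightarrow> OMap F a \<in> Obj C"
  using is_functorD(1) by (rule PiE_mem)

lemma is_functorI:
  assumes "OMap F \<in> extensional (Obj D)" "MMap F \<in> extensional (Arr D)"
    and "\<And>a. a \<in> Obj D \<Longrightarrow> OMap F a \<in> Obj C"
    and "\<And>f a b. f \<in> Hom D a b \<Longrightarrow> MMap F f \<in> Hom C (OMap F a) (OMap F b)"
    and "\<And>a. a \<in> Obj D \<Longrightarrow> MMap F (Idt D a) = Idt C (OMap F a)"
    and "\<And>f g a b c. \<lbrakk>f \<in> Hom D a b; g \<in> Hom D b c\<rbrakk>
      \<Longrightarrow> MMap F (Cmp D g f) = Cmp C (MMap F g) (MMap F f)"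
  shows "is_functor D C F"
  unfolding is_functor_def
proof (intro conjI ballI impI)
  show "OMap F \<in> Obj D \<rightarrow>\<^sub>E Obj C" using assms by (auto simp: PiE_def)
  show "MMap F f \<in> Hom C (OMap F (Dom D f)) (OMap F (Cod D f))" if "f \<in> Arr D" for f
    using that by (intro assms) (simp add: Hom_def)
  then show "MMap F \<in> Arr D \<rightarrow>\<^sub>E Arr C" using assms(2) by (auto simp: PiE_def Hom_def)
qed (auto intro: assms simp: Hom_def)

lemma is_functor_comp:
  assumes F: "is_functor D' D F" and G: "is_functor D C G" and D': "category D'"
  shows "is_functor D' C (functor_comp D' G F)"
proof -
  interpret category D' by fact
  show ?thesis
  proof (rule is_functorI)
    fix f a b assume f: "f \<in> Hom D' a b"
    then show "MMap (functor_comp D' G F) f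
        \<in> Hom C (OMap (functor_comp D' G F) a) (OMap (functor_comp D' G F) b)"
      using Hom_Obj[OF f] HomD(1)[OF f] is_functorD(3)[OF G is_functorD(3)[OF F f]]
      by (simp add: functor_comp_def)
  next
    fix f g a b c assume fg: "f \<in> Hom D' a b" "g \<in> Hom D' b c"
    then show "MMap (functor_comp D' G F) (Cmp D' g f)
        = Cmp C (MMap (functor_comp D' G F) g) (MMap (functor_comp D' G F) f)"
      using HomD(1)[OF fg(1)] HomD(1)[OF fg(2)] HomD(1)[OF Cmp_in[OF fg]]
        is_functorD(5)[OF F fg] is_functorD(5)[OF G is_functorD(3)[OF F fg(1)] is_functorD(3)[OF F fg(2)]]
      by (simp add: functor_comp_def)
  next
    fix a assume a: "a \<in> Obj D'"
    show "MMap (functor_comp D' G F) (Idt D' a) = Idt C (OMap (functor_comp D' G F) a)"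
      using a HomD(1)[OF Idt_in[OF a]] is_functorD(4)[OF F a]
        is_functorD(4)[OF G is_functor_Obj[OF F a]]
      by (simp add: functor_comp_def)
  qed (simp_all add: functor_comp_def is_functor_Obj[OF G] is_functor_Obj[OF F])
qed

lemma is_iso_functor:
  assumes F: "is_functor D C F" and "category D" "category C" and f: "f \<in> Hom D a b" "is_iso D f"
  shows "is_iso C (MMap F f)"
proof -
  interpret D: category D by fact
  interpret C: category C by fact
  obtain g where g: "g \<in> Hom D b a" "Cmp D g f = Idt D a" "Cmp D f g = Idt D b"
    using f D.is_iso_iff by blast
  have "Cmp C (MMap F g) (MMap F f) = Idt C (OMap F a)"
    using is_functorD(5)[OF F f(1) g(1)] g is_functorD(4)[OF F D.Hom_Obj(1)[OF f(1)]] by simp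
  moreover have "Cmp C (MMap F f) (MMap F g) = Idt C (OMap F b)"
    using is_functorD(5)[OF F g(1) f(1)] g is_functorD(4)[OF F D.Hom_Obj(2)[OF f(1)]] by simp
  ultimately show ?thesis
    using C.is_iso_iff[OF is_functorD(3)[OF F f(1)]] is_functorD(3)[OF F g(1)] by blast
qed

section \<open>Functor categories and the categories \<open>iS C I\<close>\<close>

lemma Hom_functor_category:
  "\<alpha> \<in> Hom (functor_category D C) F G \<longleftrightarrow> (\<exists>\<eta>. \<alpha> = (F, G, \<eta>) \<and> is_functor D C F \<and> is_functor D C G \<and>
     \<eta> \<in> extensional (Obj D) \<and> (\<forall>a \<in> Obj D. \<eta> a \<in> Hom C (OMap F a) (OMap G a)) \<and>
     (\<forall>f \<in> Arr D. Cmp C (MMap G f) (\<eta> (Dom D f)) = Cmp C (\<eta> (Cod D f)) (MMap F f)))"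
  by (auto simp: Hom_def functor_category_def)

lemma category_functor_category:
  assumes "category D" "category C"
  shows "category (functor_category D C)"
proof -
  interpret D: category D by fact
  interpret C: category C by fact
  let ?E = "functor_category D C"
  show ?thesis
  proof
    fix F assume F: "F \<in> Obj ?E"
    then have F': "is_functor D C F" by (simp add: functor_category_def)
    note [simp] = is_functor_Obj[OF F']
    have "Cmp C (MMap F f) (Idt C (OMap F (Dom D f))) = Cmp C (Idt C (OMap F (Cod D f))) (MMap F f)"
      if "f \<in> Arr D" for f
      using is_functorD(3)[OF F' D.Arr_Hom[OF that]] by (simp add: C.Cmp_Idt C.Idt_Cmp)
    then show "Idt ?E F \<in> Hom ?E F F"
      using F' unfolding Hom_functor_category
      by (simp add: functor_category_def C.Idt_in D.Dom_in D.Cod_in)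
  next
    fix \<alpha> \<beta> F G H assume "\<alpha> \<in> Hom ?E F G" "\<beta> \<in> Hom ?E G H"
    then obtain \<eta> \<theta> where e: "\<alpha> = (F, G, \<eta>)" "\<beta> = (G, H, \<theta>)"
      and func: "is_functor D C F" "is_functor D C G" "is_functor D C H"
      and \<eta>: "\<And>a. a \<in> Obj D \<Longrightarrow> \<eta> a \<in> Hom C (OMap F a) (OMap G a)"
        "\<And>f. f \<in> Arr D \<Longrightarrow> Cmp C (MMap G f) (\<eta> (Dom D f)) = Cmp C (\<eta> (Cod D f)) (MMap F f)"
      and \<theta>: "\<And>a. a \<in> Obj D \<Longrightarrow> \<theta> a \<in> Hom C (OMap G a) (OMap H a)"
        "\<And>f. f \<in> Arr D \<Longrightarrow> Cmp C (MMap H f) (\<theta> (Dom D f)) = Cmp C (\<theta> (Cod D f)) (MMap G f)"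
      unfolding Hom_functor_category by blast
    \<comment> \<open>Two naturality squares are pasted, first that of \<theta>, then that of
      \<eta>.\<close>
    have "Cmp C (MMap H f) (Cmp C (\<theta> (Dom D f)) (\<eta> (Dom D f)))
        = Cmp C (Cmp C (\<theta> (Cod D f)) (\<eta> (Cod D f))) (MMap F f)" if f: "f \<in> Arr D" for f
    proof -
      note dom = D.Dom_in[OF f] and cod = D.Cod_in[OF f]
      note M = is_functorD(3)[OF _ D.Arr_Hom[OF f]]
      have "Cmp C (MMap H f) (Cmp C (\<theta> (Dom D f)) (\<eta> (Dom D f)))
          = Cmp C (Cmp C (\<theta> (Cod D f)) (MMap G f)) (\<eta> (Dom D f))"
        by (simp add: C.Cmp_assoc[OF \<eta>(1)[OF dom] \<theta>(1)[OF dom] M[OF func(3)]] \<theta>(2)[OF f])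
      also have "\<dots> = Cmp C (\<theta> (Cod D f)) (Cmp C (\<eta> (Cod D f)) (MMap F f))"
        by (simp add: C.Cmp_assoc[OF \<eta>(1)[OF dom] M[OF func(2)] \<theta>(1)[OF cod], symmetric] \<eta>(2)[OF f])
      also have "\<dots> = Cmp C (Cmp C (\<theta> (Cod D f)) (\<eta> (Cod D f))) (MMap F f)"
        by (rule C.Cmp_assoc[OF M[OF func(1)] \<eta>(1)[OF cod] \<theta>(1)[OF cod]])
      finally show ?thesis .
    qed
    then show "Cmp ?E \<beta> \<alpha> \<in> Hom ?E F H"
      using func unfolding Hom_functor_category
      by (auto simp: e functor_category_def D.Dom_in D.Cod_in intro: C.Cmp_in[OF \<eta>(1) \<theta>(1)])
  next
    fix \<alpha> F G assume "\<alpha> \<in> Hom ?E F G"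
    then obtain \<eta> where e: "\<alpha> = (F, G, \<eta>)" and ext: "\<eta> \<in> extensional (Obj D)"
      and \<eta>: "\<And>a. a \<in> Obj D \<Longrightarrow> \<eta> a \<in> Hom C (OMap F a) (OMap G a)"
      unfolding Hom_functor_category by blast
    show "Cmp ?E \<alpha> (Idt ?E F) = \<alpha>" "Cmp ?E (Idt ?E G) \<alpha> = \<alpha>"
      by (auto simp: e functor_category_def C.Cmp_Idt[OF \<eta>] C.Idt_Cmp[OF \<eta>]
        intro: extensionalityI[OF _ ext])
  next
    fix \<alpha> \<beta> \<gamma> F G H K assume "\<alpha> \<in> Hom ?E F G" "\<beta> \<in> Hom ?E G H" "\<gamma> \<in> Hom ?E H K"
    then obtain \<eta> \<theta> \<zeta> where e: "\<alpha> = (F, G, \<eta>)" "\<beta> = (G, H, \<theta>)" "\<gamma> = (H, K, \<zeta>)"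
      and h: "\<And>a. a \<in> Obj D \<Longrightarrow> \<eta> a \<in> Hom C (OMap F a) (OMap G a)"
        "\<And>a. a \<in> Obj D \<Longrightarrow> \<theta> a \<in> Hom C (OMap G a) (OMap H a)"
        "\<And>a. a \<in> Obj D \<Longrightarrow> \<zeta> a \<in> Hom C (OMap H a) (OMap K a)"
      unfolding Hom_functor_category by blast
    show "Cmp ?E \<gamma> (Cmp ?E \<beta> \<alpha>) = Cmp ?E (Cmp ?E \<gamma> \<beta>) \<alpha>"
      by (auto simp: e functor_category_def C.Cmp_assoc[OF h])
  qed (auto simp: functor_category_def)
qed

lemma category_S_cat: "category C \<Longrightarrow> category (S_cat C I)"
  unfolding S_cat_def
  by (intro category_full_subcategory category_functor_category category_Ar)

lemma category_iS: "category C \<Longrightarrow> category (iS C I)"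
  unfolding iS_def by (intro category_core category_S_cat)

text \<open>An arrow of the core has an inverse natural transformation \<theta>; comparing the
  components at \<open>a\<close> of the two identities shows that \<open>\<theta> a\<close> inverts
  \<open>\<eta> a\<close>.\<close>

lemma iS_Hom_components:
  assumes "category C" and \<alpha>: "(F, G, \<eta>) \<in> Hom (iS C I) A B" and a: "a \<in> Obj (Ar I)"
  shows "\<eta> a \<in> Hom C (OMap A a) (OMap B a)" "is_iso C (\<eta> a)"
proof -
  interpret category C by fact
  obtain \<theta> where FG: "F = A" "G = B" and \<eta>: "\<eta> a \<in> Hom C (OMap A a) (OMap B a)"
    and \<theta>: "\<theta> a \<in> Hom C (OMap B a) (OMap A a)"
    and id: "Cmp (functor_category (Ar I) C) (B, A, \<theta>) (A, B, \<eta>) = Idt (functor_category (Ar I) C) A"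
      "Cmp (functor_category (Ar I) C) (A, B, \<eta>) (B, A, \<theta>) = Idt (functor_category (Ar I) C) B"
    using \<alpha> a
    by (auto simp: iS_def core_def Hom_def is_iso_def S_cat_def full_subcategory_def functor_category_def)
  show "\<eta> a \<in> Hom C (OMap A a) (OMap B a)" by fact
  have "Cmp C (\<theta> a) (\<eta> a) = Idt C (OMap A a)"
    using id(1) a by (auto simp: functor_category_def dest: fun_cong[of _ _ a])
  moreover have "Cmp C (\<eta> a) (\<theta> a) = Idt C (OMap B a)"
    using id(2) a by (auto simp: functor_category_def dest: fun_cong[of _ _ a])
  ultimately show "is_iso C (\<eta> a)" using is_iso_iff[OF \<eta>] \<theta> by blast
qed

section \<open>Restriction and precomposition of functors\<close>

text \<open>Functors are extensional, so a restriction has to be undefined outside the smaller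
  category. The operation serves both for functors out of a subcategory and for the passage from
  \<open>Ar J\<close> to \<open>Ar I\<close>.\<close>

definition restrict_functor where
  "restrict_functor D F = \<lparr>OMap = restrict (OMap F) (Obj D), MMap = restrict (MMap F) (Arr D)\<rparr>"

lemma is_functor_full_subcategory:
  fixes C :: "('o, 'm) precategory" and D :: "('p, 'q) precategory"
  assumes F: "is_functor C D F" and "category C"
    and PQ: "\<And>a. \<lbrakk>a \<in> Obj C; P a\<rbrakk> \<Longrightarrow> Q (OMap F a)"
  shows "is_functor (full_subcategory C P) (full_subcategory D Q)
    (restrict_functor (full_subcategory C P) F)"
proof -
  interpret category C by fact
  interpret S: category "full_subcategory C P" by (rule category_full_subcategory) fact
  have sub: "f \<in> Hom (full_subcategory C P) a b \<Longrightarrow> f \<in> Hom C a b \<and> P a \<and> P b" for f a b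
    by (auto simp: full_subcategory_def Hom_def)
  have sup: "\<lbrakk>f \<in> Hom D a b; Q a; Q b\<rbrakk> \<Longrightarrow> f \<in> Hom (full_subcategory D Q) a b" for f a b
    by (auto simp: full_subcategory_def Hom_def)
  have Obj: "a \<in> Obj (full_subcategory C P) \<longleftrightarrow> a \<in> Obj C \<and> P a" for a
    by (auto simp: full_subcategory_def)
  show ?thesis
  proof (rule is_functorI)
    fix f a b assume f: "f \<in> Hom (full_subcategory C P) a b"
    then have f': "f \<in> Hom C a b" "P a" "P b" using sub by auto
    then show "MMap (restrict_functor (full_subcategory C P) F) f
        \<in> Hom (full_subcategory D Q) (OMap (restrict_functor (full_subcategory C P) F) a)
            (OMap (restrict_functor (full_subcategory C P) F) b)"
      using HomD(1)[OF f] S.Hom_Obj[OF f] Hom_Obj[OF f'(1)] is_functorD(3)[OF F f'(1)]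
      by (simp add: restrict_functor_def sup PQ)
  next
    fix f g a b c assume fg: "f \<in> Hom (full_subcategory C P) a b" "g \<in> Hom (full_subcategory C P) b c"
    then show "MMap (restrict_functor (full_subcategory C P) F) (Cmp (full_subcategory C P) g f) =
        Cmp (full_subcategory D Q) (MMap (restrict_functor (full_subcategory C P) F) g)
          (MMap (restrict_functor (full_subcategory C P) F) f)"
      using HomD(1)[OF fg(1)] HomD(1)[OF fg(2)] HomD(1)[OF S.Cmp_in[OF fg]]
        is_functorD(5)[OF F conjunct1[OF sub[OF fg(1)]] conjunct1[OF sub[OF fg(2)]]]
      by (simp add: restrict_functor_def) (simp add: full_subcategory_def)
  next
    fix a assume a: "a \<in> Obj (full_subcategory C P)"
    then show "MMap (restrict_functor (full_subcategory C P) F) (Idt (full_subcategory C P) a) =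
        Idt (full_subcategory D Q) (OMap (restrict_functor (full_subcategory C P) F) a)"
      using HomD(1)[OF S.Idt_in[OF a]] is_functorD(4)[OF F] Obj[of a]
      by (simp add: restrict_functor_def) (simp add: full_subcategory_def)
  next
    fix a assume "a \<in> Obj (full_subcategory C P)"
    then show "OMap (restrict_functor (full_subcategory C P) F) a \<in> Obj (full_subcategory D Q)"
      using is_functor_Obj[OF F] PQ by (simp add: restrict_functor_def full_subcategory_def)
  qed (simp_all add: restrict_functor_def)
qed

lemma is_functor_core:
  fixes C :: "('o, 'm) precategory" and D :: "('p, 'q) precategory"
  assumes F: "is_functor C D F" and C: "category C" and D: "category D"
  shows "is_functor (core C) (core D) (restrict_functor (core C) F)"
proof -
  interpret C: category C by fact
  interpret S: category "core C" by (rule category_core) fact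
  have Hom: "f \<in> Hom (core C) a b \<longleftrightarrow> f \<in> Hom C a b \<and> is_iso C f" for f a b
    by (auto simp: core_def Hom_def)
  have HomD': "f \<in> Hom (core D) a b \<longleftrightarrow> f \<in> Hom D a b \<and> is_iso D f" for f a b
    by (auto simp: core_def Hom_def)
  show ?thesis
  proof (rule is_functorI)
    fix f a b assume f: "f \<in> Hom (core C) a b"
    then have f': "f \<in> Hom C a b" "is_iso C f" using Hom by auto
    then show "MMap (restrict_functor (core C) F) f
        \<in> Hom (core D) (OMap (restrict_functor (core C) F) a) (OMap (restrict_functor (core C) F) b)"
      using HomD(1)[OF f] S.Hom_Obj[OF f] is_functorD(3)[OF F f'(1)] is_iso_functor[OF F C D f']
      by (simp add: restrict_functor_def HomD')
  next
    fix f g a b c assume fg: "f \<in> Hom (core C) a b" "g \<in> Hom (core C) b c"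
    then show "MMap (restrict_functor (core C) F) (Cmp (core C) g f) =
        Cmp (core D) (MMap (restrict_functor (core C) F) g) (MMap (restrict_functor (core C) F) f)"
      using HomD(1)[OF fg(1)] HomD(1)[OF fg(2)] HomD(1)[OF S.Cmp_in[OF fg]]
        is_functorD(5)[OF F conjunct1[OF iffD1[OF Hom fg(1)]] conjunct1[OF iffD1[OF Hom fg(2)]]]
      by (simp add: restrict_functor_def) (simp add: core_def)
  next
    fix a assume a: "a \<in> Obj (core C)"
    then show "MMap (restrict_functor (core C) F) (Idt (core C) a) =
        Idt (core D) (OMap (restrict_functor (core C) F) a)"
      using HomD(1)[OF S.Idt_in[OF a]] is_functorD(4)[OF F]
      by (simp add: restrict_functor_def) (simp add: core_def)
  next
    fix a assume "a \<in> Obj (core C)"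
    then show "OMap (restrict_functor (core C) F) a \<in> Obj (core D)"
      using is_functor_Obj[OF F] by (simp add: restrict_functor_def core_def)
  qed (simp_all add: restrict_functor_def)
qed

lemma is_functor_precomp:
  assumes F: "is_functor D' D F" and D': "category D'" and D: "category D" and C: "category C"
  shows "is_functor (functor_category D C) (functor_category D' C)
    (precomp_functor D' (functor_category D C) F)"
proof -
  let ?E = "functor_category D C"
  interpret E: category ?E by (rule category_functor_category[OF D C])
  interpret D': category D' by fact
  note FO = is_functor_Obj[OF F]
  have R: "is_functor D C G \<Longrightarrow> is_functor D' C (functor_comp D' G F)" for G
    using is_functor_comp[OF F _ D'] .
  show ?thesis
  proof (rule is_functorI)
    fix \<alpha> G H assume \<alpha>: "\<alpha> \<in> Hom ?E G H"
    then obtain \<eta> where e: "\<alpha> = (G, H, \<eta>)" and GH: "is_functor D C G" "is_functor D C H"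
      and \<eta>: "\<And>a. a \<in> Obj D \<Longrightarrow> \<eta> a \<in> Hom C (OMap G a) (OMap H a)"
        "\<And>f. f \<in> Arr D \<Longrightarrow> Cmp C (MMap H f) (\<eta> (Dom D f)) = Cmp C (\<eta> (Cod D f)) (MMap G f)"
      unfolding Hom_functor_category by blast
    \<comment> \<open>Whiskering: the naturality of \<eta> is used at the arrow
      \<open>MMap F f\<close>.\<close>
    have "Cmp C (MMap H (MMap F f)) (\<eta> (OMap F (Dom D' f)))
        = Cmp C (\<eta> (OMap F (Cod D' f))) (MMap G (MMap F f))" if "f \<in> Arr D'" for f
      using \<eta>(2) HomD[OF is_functorD(3)[OF F D'.Arr_Hom[OF that]]] by metis
    then show "MMap (precomp_functor D' ?E F) \<alpha> \<in> Hom (functor_category D' C)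
        (OMap (precomp_functor D' ?E F) G) (OMap (precomp_functor D' ?E F) H)"
      using HomD(1)[OF \<alpha>] E.Hom_Obj[OF \<alpha>] GH[THEN R] \<eta>(1)[OF FO]
      by (simp add: precomp_functor_def Hom_functor_category e)
        (simp add: functor_comp_def D'.Dom_in D'.Cod_in)
  next
    fix \<alpha> \<beta> G H K assume ab: "\<alpha> \<in> Hom ?E G H" "\<beta> \<in> Hom ?E H K"
    then obtain \<eta> \<theta> where e: "\<alpha> = (G, H, \<eta>)" "\<beta> = (H, K, \<theta>)"
      unfolding Hom_functor_category by blast
    have c: "Cmp ?E \<beta> \<alpha> = (G, K, \<lambda>a \<in> Obj D. Cmp C (\<theta> a) (\<eta> a))"
      by (simp add: e functor_category_def)
    have c': "Cmp (functor_category D' C) (G2, K2, \<theta>2) (G1, K1, \<theta>1)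
        = (G1, K2, \<lambda>a \<in> Obj D'. Cmp C (\<theta>2 a) (\<theta>1 a))" for G1 G2 K1 K2 \<theta>1 \<theta>2
      by (simp add: functor_category_def)
    show "MMap (precomp_functor D' ?E F) (Cmp ?E \<beta> \<alpha>) = Cmp (functor_category D' C)
        (MMap (precomp_functor D' ?E F) \<beta>) (MMap (precomp_functor D' ?E F) \<alpha>)"
      using HomD(1)[OF ab(1)] HomD(1)[OF ab(2)] HomD(1)[OF E.Cmp_in[OF ab]]
      by (auto simp: precomp_functor_def c[unfolded e] e c' FO)
  next
    fix G assume G: "G \<in> Obj ?E"
    have i: "Idt ?E G = (G, G, \<lambda>a \<in> Obj D. Idt C (OMap G a))"
      by (simp add: functor_category_def)
    show "MMap (precomp_functor D' ?E F) (Idt ?E G)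
        = Idt (functor_category D' C) (OMap (precomp_functor D' ?E F) G)"
      using G HomD(1)[OF E.Idt_in[OF G]]
      by (auto simp: precomp_functor_def i FO) (auto simp: functor_category_def functor_comp_def FO)
  next
    fix G assume "G \<in> Obj ?E"
    then show "OMap (precomp_functor D' ?E F) G \<in> Obj (functor_category D' C)"
      using R by (simp add: precomp_functor_def functor_category_def)
  qed (simp_all add: precomp_functor_def)
qed

text \<open>\<open>precomp_functor\<close> reads \<open>E\<close> only through its objects and
  arrows. Thus functoriality, once proved on the whole functor category, can be handed down to
  \<open>S_cat\<close> and \<open>iS\<close>.\<close>

lemma precomp_functor_restrict:
  assumes "Obj E \<subseteq> Obj E'" "Arr E \<subseteq> Arr E'"
  shows "precomp_functor D' E F = restrict_functor E (precomp_functor D' E' F)"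
  using assms by (auto simp: precomp_functor_def restrict_functor_def subset_iff intro!: ext)

section \<open>Restriction along inclusions of index sets\<close>

lemma Obj_Ar: "(i, j) \<in> Obj (Ar I) \<longleftrightarrow> i \<in> I \<and> j \<in> I \<and> i \<le> j"
  by (simp add: Ar_def poset_category_def)

lemma Arr_Ar:
  "(p, q) \<in> Arr (Ar I) \<longleftrightarrow> p \<in> Obj (Ar I) \<and> q \<in> Obj (Ar I) \<and> fst p \<le> fst q \<and> snd p \<le> snd q"
  by (auto simp: Ar_def poset_category_def)

text \<open>The product of identities is left unsimplified so that the term matches the body of
  \<open>iS_map\<close> for the inclusion \<open>\<lambda>i. i\<close>.\<close>

definition Ar_incl :: "nat set \<Rightarrow>
    (nat \<times> nat, (nat \<times> nat) \<times> nat \<times> nat, nat \<times> nat, (nat \<times> nat) \<times> nat \<times> nat) prefunctor" where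
  "Ar_incl I = poset_functor (Ar I) (map_prod (\<lambda>i. i) (\<lambda>i. i))"

lemma is_functor_Ar_incl:
  assumes "I \<subseteq> J"
  shows "is_functor (Ar I) (Ar J) (Ar_incl I)"
proof -
  interpret category "Ar I" by (rule category_Ar)
  have id: "map_prod (\<lambda>i. i) (\<lambda>i. i) = (\<lambda>x :: nat \<times> nat. x)" by auto
  have id': "map_prod (\<lambda>i. i) (\<lambda>i. i) = (\<lambda>x :: (nat \<times> nat) \<times> nat \<times> nat. x)" by auto
  show ?thesis
    using assms unfolding Ar_incl_def poset_functor_def id id'
    by (intro is_functorI)
      (auto simp: Ar_def poset_category_def Hom_def)
qed

lemma functor_comp_Ar_incl: "functor_comp (Ar I) G (Ar_incl I) = restrict_functor (Ar I) G"
  by (auto simp: functor_comp_def restrict_functor_def Ar_incl_def poset_functor_def)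

text \<open>Precomposition is first a functor of functor categories. It restricts to the
  \<open>S_cat\<close>s, because the conditions indexed by \<open>I\<close> are among those indexed
  by \<open>J\<close>, and then to the cores, because functors preserve isomorphisms.\<close>

lemma is_functor_iS_map:
  assumes C: "category C" and IJ: "I \<subseteq> J"
  shows "is_functor (iS C J) (iS C I) (iS_map C I J (\<lambda>i. i))"
proof -
  let ?E = "functor_category (Ar J) C" and ?E' = "functor_category (Ar I) C"
  have E: "category ?E" by (intro category_functor_category category_Ar C)
  have "is_functor ?E ?E' (precomp_functor (Ar I) ?E (Ar_incl I))"
    by (intro is_functor_precomp is_functor_Ar_incl IJ category_Ar C)
  then have "is_functor (S_cat C J) (S_cat C I)
      (restrict_functor (S_cat C J) (precomp_functor (Ar I) ?E (Ar_incl I)))"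
    unfolding S_cat_def
  proof (rule is_functor_full_subcategory[OF _ E])
    fix A
    assume "A \<in> Obj ?E"
      "(\<forall>j \<in> J. OMap A (j, j) = Zero C) \<and>
       (\<forall>i \<in> J. \<forall>j \<in> J. \<forall>k \<in> J. i < j \<and> j < k \<longrightarrow>
          cofibration_sequence C (MMap A ((i, j), (i, k))) (MMap A ((i, k), (j, k))))"
    then show "(\<forall>j \<in> I. OMap (OMap (precomp_functor (Ar I) ?E (Ar_incl I)) A) (j, j) = Zero C) \<and>
       (\<forall>i \<in> I. \<forall>j \<in> I. \<forall>k \<in> I. i < j \<and> j < k \<longrightarrow>
          cofibration_sequence C (MMap (OMap (precomp_functor (Ar I) ?E (Ar_incl I)) A) ((i, j), (i, k)))
            (MMap (OMap (precomp_functor (Ar I) ?E (Ar_incl I)) A) ((i, k), (j, k))))"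
      using IJ
      by (auto simp: precomp_functor_def functor_comp_Ar_incl restrict_functor_def Obj_Ar Arr_Ar subset_iff)
  qed
  also have "restrict_functor (S_cat C J) (precomp_functor (Ar I) ?E (Ar_incl I)) =
      precomp_functor (Ar I) (S_cat C J) (Ar_incl I)"
    by (rule precomp_functor_restrict[symmetric]) (auto simp: S_cat_def full_subcategory_def)
  finally have "is_functor (core (S_cat C J)) (core (S_cat C I))
      (restrict_functor (core (S_cat C J)) (precomp_functor (Ar I) (S_cat C J) (Ar_incl I)))"
    by (intro is_functor_core category_S_cat C)
  also have "restrict_functor (core (S_cat C J)) (precomp_functor (Ar I) (S_cat C J) (Ar_incl I)) =
      precomp_functor (Ar I) (core (S_cat C J)) (Ar_incl I)"
    by (rule precomp_functor_restrict[symmetric]) (auto simp: core_def)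
  finally show ?thesis by (simp add: iS_def iS_map_def Ar_incl_def)
qed

lemma OMap_iS_map:
  "A \<in> Obj (iS C J) \<Longrightarrow> OMap (iS_map C I J (\<lambda>i. i)) A = restrict_functor (Ar I) A"
  unfolding iS_map_def Ar_incl_def[symmetric]
  by (simp add: precomp_functor_def functor_comp_Ar_incl)

lemma restrict_functor_Ar:
  assumes "I \<subseteq> J"
  shows "restrict_functor (Ar I) (restrict_functor (Ar J) A) = restrict_functor (Ar I) A"
proof -
  have "Obj (Ar J) \<inter> Obj (Ar I) = Obj (Ar I)" "Arr (Ar J) \<inter> Arr (Ar I) = Arr (Ar I)"
    using assms by (auto simp: Obj_Ar Arr_Ar)
  then show ?thesis by (simp add: restrict_functor_def)
qed


section \<open>Realizations and path components\<close>

text \<open>The constructor \<open>topology\<close> has the intended open sets only for families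
  that satisfy \<open>istopology\<close>; here this holds because preimages under \<open>q\<close>
  commute with intersections and unions.\<close>

lemma openin_quotient_topology:
  "openin (quotient_topology X q) U \<longleftrightarrow>
    U \<subseteq> q ` topspace X \<and> openin X {x \<in> topspace X. q x \<in> U}"
proof -
  let ?op = "\<lambda>U. U \<subseteq> q ` topspace X \<and> openin X {x \<in> topspace X. q x \<in> U}"
  have "istopology ?op"
    unfolding istopology_def
  proof (intro conjI allI impI)
    fix S T assume "?op S" "?op T"
    moreover have "{x \<in> topspace X. q x \<in> S \<inter> T} =
        {x \<in> topspace X. q x \<in> S} \<inter> {x \<in> topspace X. q x \<in> T}" by auto
    ultimately show "S \<inter> T \<subseteq> q ` topspace X" "openin X {x \<in> topspace X. q x \<in> S \<inter> T}"
      by (auto simp only: openin_Int)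
  next
    fix \<K> assume "\<forall>K\<in>\<K>. ?op K"
    moreover have "{x \<in> topspace X. q x \<in> \<Union>\<K>} = (\<Union>K\<in>\<K>. {x \<in> topspace X. q x \<in> K})" by auto
    ultimately show "\<Union>\<K> \<subseteq> q ` topspace X" "openin X {x \<in> topspace X. q x \<in> \<Union>\<K>}" by auto
  qed
  then show ?thesis by (simp add: quotient_topology_def)
qed

lemma topspace_quotient_topology: "topspace (quotient_topology X q) = q ` topspace X"
proof -
  have "{x \<in> topspace X. q x \<in> q ` topspace X} = topspace X" by auto
  then have "openin (quotient_topology X q) (q ` topspace X)"
    by (simp add: openin_quotient_topology)
  then have "q ` topspace X \<subseteq> topspace (quotient_topology X q)" by (rule openin_subset)
  moreover have "topspace (quotient_topology X q) \<subseteq> q ` topspace X"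
    using openin_topspace openin_quotient_topology by metis
  ultimately show ?thesis by blast
qed

lemma topspace_cells:
  "topspace (cells X) = {(p, x, t). x \<in> Simp X p \<and> t \<in> standard_simplex p}"
  by (auto simp: cells_def simplex_topology_def)

lemma topspace_realization: "topspace (realization X) = cell_class X ` topspace (cells X)"
  by (simp add: realization_def topspace_quotient_topology)

lemma cell_class_eq_iff: "cell_class X z = cell_class X w \<longleftrightarrow> equivclp (glue X) z w"
proof
  assume "cell_class X z = cell_class X w"
  then have "w \<in> cell_class X z" by (simp add: cell_class_def)
  then show "equivclp (glue X) z w" by (simp add: cell_class_def)
next
  assume "equivclp (glue X) z w"
  then show "cell_class X z = cell_class X w"
    unfolding cell_class_def by (blast intro: equivclp_sym equivclp_trans)
qed

lemma in_cell_class: "z \<in> cell_class X z"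
  by (simp add: cell_class_def)

lemma equivclp_invariant:
  assumes "equivclp r x y" and "\<And>x y. r x y \<Longrightarrow> \<phi> x = \<phi> y"
  shows "\<phi> x = \<phi> y"
  using assms(1) by (induction rule: equivclp_induct) (auto simp: assms(2))

text \<open>Such a \<open>v\<close> descends to a locally constant function on the realization.\<close>

lemma realization_path_invariant:
  fixes X :: "'s simplicial_set" and v :: "nat \<Rightarrow> 's \<Rightarrow> 'b"
  assumes v: "\<And>m n \<theta> x. \<lbrakk>monotone_on {..m} (\<le>) (\<le>) \<theta>; \<theta> ` {..m} \<subseteq> {..n}; x \<in> Simp X n\<rbrakk>
      \<Longrightarrow> v m (Act X m n \<theta> x) = v n x"
    and path: "path_component_of (realization X) (cell_class X (p, x, t)) (cell_class X (q, y, u))"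
  shows "v p x = v q y"
proof -
  \<comment> \<open>\<open>g\<close> reads \<open>v\<close> off a chosen representative; the choice
    is immaterial because \<open>v\<close> is invariant under \<open>glue\<close>.\<close>
  define g :: "(nat \<times> 's \<times> (nat \<Rightarrow> real)) set \<Rightarrow> 'b" where "g c = (case (SOME z. z \<in> c) of (p, x, t) \<Rightarrow> v p x)" for c
  let ?i = "\<lambda>z. case z of (p, x, t) \<Rightarrow> v p x"
  have g: "g (cell_class X z) = ?i z" for z
  proof -
    have "equivclp (glue X) z (SOME w. w \<in> cell_class X z)"
      using someI[of "\<lambda>w. w \<in> cell_class X z", OF in_cell_class] by (simp add: cell_class_def)
    then have "?i z = ?i (SOME w. w \<in> cell_class X z)"
      by (rule equivclp_invariant) (auto elim!: glue.cases simp: v)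
    then show ?thesis by (simp add: g_def)
  qed
  have "continuous_map (realization X) (discrete_topology UNIV) g"
    unfolding continuous_map_def
  proof (intro conjI allI impI)
    fix V :: "'b set"
    \<comment> \<open>As \<open>v\<close> ignores the simplex coordinate, this set is a union of
      full copies of simplices in each summand, hence open.\<close>
    have "openin (cells X) {z \<in> topspace (cells X). ?i z \<in> V}"
      unfolding cells_def openin_sum_topology
    proof (intro conjI ballI)
      fix p
      let ?Y = "prod_topology (discrete_topology (Simp X p)) (simplex_topology p)"
      have "openin ?Y ({x \<in> Simp X p. v p x \<in> V} \<times> topspace (simplex_topology p))"
        by (simp add: openin_prod_Times_iff)
      moreover have "{x. (p, x) \<in> {z \<in> topspace (cells X). ?i z \<in> V}} =
          {x \<in> Simp X p. v p x \<in> V} \<times> topspace (simplex_topology p)"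
        by (auto simp: topspace_cells simplex_topology_def)
      ultimately show "openin ?Y {x. (p, x) \<in> {z \<in> topspace (sum_topology
          (\<lambda>p. prod_topology (discrete_topology (Simp X p)) (simplex_topology p)) UNIV). ?i z \<in> V}}"
        by (simp add: cells_def)
    qed auto
    moreover have "{z \<in> topspace (cells X). cell_class X z \<in> {c \<in> topspace (realization X). g c \<in> V}}
        = {z \<in> topspace (cells X). ?i z \<in> V}"
      by (auto simp: topspace_realization g)
    ultimately show "openin (realization X) {c \<in> topspace (realization X). g c \<in> V}"
      unfolding realization_def openin_quotient_topology topspace_quotient_topology
      by (simp add: Collect_mono_iff)
  qed simp
  moreover obtain \<gamma> where "pathin (realization X) \<gamma>"
    and ends: "\<gamma> 0 = cell_class X (p, x, t)" "\<gamma> 1 = cell_class X (q, y, u)"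
    using path by (auto simp: path_component_of_def)
  ultimately have "pathin (discrete_topology UNIV) (g \<circ> \<gamma>)"
    by (metis continuous_map_compose pathin_def)
  \<comment> \<open>A path in a discrete space has connected image, hence is constant.\<close>
  then have "connectedin (discrete_topology UNIV) ((g \<circ> \<gamma>) ` {0..1})"
    by (rule connectedin_path_image)
  then obtain a where "(g \<circ> \<gamma>) ` {0..1} \<subseteq> {a}" by (auto simp: connectedin_discrete_topology)
  then have "g (\<gamma> 0) = a" "g (\<gamma> 1) = a" by (auto simp: image_subset_iff)
  then show ?thesis by (simp add: ends g)
qed

text \<open>A simplicial map carries glued points to glued points, so all the classes in the union
  defining \<open>realization_map\<close> coincide.\<close>

lemma realization_map_cell_class:
  assumes Simp: "\<And>n x. x \<in> Simp X n \<Longrightarrow> \<phi> n x \<in> Simp Y n"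
    and Act: "\<And>m n \<theta> x. \<lbrakk>monotone_on {..m} (\<le>) (\<le>) \<theta>; \<theta> ` {..m} \<subseteq> {..n}; x \<in> Simp X n\<rbrakk>
      \<Longrightarrow> \<phi> m (Act X m n \<theta> x) = Act Y m n \<theta> (\<phi> n x)"
  shows "realization_map Y \<phi> (cell_class X (p, x, t)) = cell_class Y (p, \<phi> p x, t)"
proof -
  let ?j = "\<lambda>z. case z of (p, x, t) \<Rightarrow> cell_class Y (p, \<phi> p x, t)"
  have j: "?j z = ?j w" if "glue X z w" for z w
    using that
  proof cases
    case (1 m \<theta> n x t)
    then have "glue Y (m, Act Y m n \<theta> (\<phi> n x), t) (n, \<phi> n x, simplex_push m \<theta> t)"
      by (intro glue.intros Simp)
    then show ?thesis using 1 by (auto simp: Act cell_class_eq_iff)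
  qed
  have "?j z = ?j (p, x, t)" if "z \<in> cell_class X (p, x, t)" for z
  proof -
    from that have "equivclp (glue X) (p, x, t) z" by (simp add: cell_class_def)
    then have "?j (p, x, t) = ?j z" by (rule equivclp_invariant) (rule j)
    then show ?thesis ..
  qed
  then have "(\<Union>z \<in> cell_class X (p, x, t). ?j z) = (\<Union>z \<in> cell_class X (p, x, t). ?j (p, x, t))"
    by (rule SUP_cong[OF refl])
  then show ?thesis 
    unfolding realization_map_def using in_cell_class[of "(p, x, t)" X] by auto
qed

text \<open>Injectivity on path components fails: the components of \<open>x\<close> and
  \<open>y\<close> differ but have the same image.\<close>

lemma not_weak_homotopy_equivalence:
  assumes xy: "x \<in> topspace X" "y \<in> topspace X" and f: "f x = f y" "f x \<in> topspace Y"
    and no_path: "\<not> path_component_of X x y"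
  shows "\<not> weak_homotopy_equivalence X Y f"
proof
  assume "weak_homotopy_equivalence X Y f"
  define U where "U c = (\<Union>x \<in> c. path_component_of_set Y (f x))" for c
  define \<pi> where "\<pi> = path_component_of_set X"
  have bij: "bij_betw U (path_components_of X) (path_components_of Y)"
    using \<open>weak_homotopy_equivalence X Y f\<close>
    by (simp add: weak_homotopy_equivalence_def U_def[abs_def])
  have \<pi>: "z \<in> \<pi> z" "\<pi> z \<in> path_components_of X" if "z \<in> topspace X" for z
    using that by (auto simp: \<pi>_def path_components_of_def path_component_of_refl)
  have fx: "f x \<in> U (\<pi> z)" if "z \<in> topspace X" "f z = f x" for z
  proof -
    have "f x \<in> path_component_of_set Y (f z)"
      using that f by (simp add: path_component_of_refl)
    then show ?thesis using \<pi>(1)[OF that(1)] unfolding U_def by (rule UN_I[rotated])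
  qed
  have U: "U (\<pi> z) \<in> path_components_of Y" if "z \<in> topspace X" for z
    using bij_betwE[OF bij] \<pi>(2)[OF that] by (rule bspec)
  \<comment> \<open>Both sets contain \<open>f x\<close>, and path components that overlap are
    equal.\<close>
  have "U (\<pi> x) \<inter> U (\<pi> y) \<noteq> {}"
    using fx[OF xy(1) refl] fx[OF xy(2) f(1)[symmetric]] by (metis IntI empty_iff)
  then have "U (\<pi> x) = U (\<pi> y)"
    by (simp add: path_components_of_overlap[OF U U] xy)
  then have "\<pi> x = \<pi> y"
    by (rule inj_onD[OF bij_betw_imp_inj_on[OF bij]]) (simp_all add: \<pi> xy)
  then have "y \<in> \<pi> x" using \<pi>(1) xy by simp
  then show False using no_path by (simp add: \<pi>_def)
qed

text \<open>\<open>nerve_map\<close> composes on one side and the simplicial structure on the other,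
  so the two commute.\<close>

lemma realization_map_nerve:
  assumes G: "is_functor D E G"
  shows "realization_map (nerve E) (nerve_map G) (cell_class (nerve D) (p, F, t))
    = cell_class (nerve E) (p, nerve_map G p F, t)"
proof (rule realization_map_cell_class)
  show "nerve_map G n F \<in> Simp (nerve E) n" if "F \<in> Simp (nerve D) n" for n F
    using that is_functor_comp[OF _ G category_ordinal] by (simp add: nerve_def nerve_map_def)
  show "nerve_map G m (Act (nerve D) m n \<theta> F) = Act (nerve E) m n \<theta> (nerve_map G n F)"
    if "monotone_on {..m} (\<le>) (\<le>) \<theta>" "\<theta> ` {..m} \<subseteq> {..n}" for m n \<theta> F
    using that
    by (auto simp: nerve_map_def nerve_def functor_comp_def poset_functor_def ordinal_def
        poset_category_def monotone_on_def image_subset_iff)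
qed

section \<open>Objects as points of the realization of a nerve\<close>

definition vertex_functor ::
  "('o, 'm, 'x) precategory_scheme \<Rightarrow> 'o \<Rightarrow> (nat, nat \<times> nat, 'o, 'm) prefunctor" where
  "vertex_functor D a =
    \<lparr>OMap = (\<lambda>i \<in> Obj (ordinal 0). a), MMap = (\<lambda>f \<in> Arr (ordinal 0). Idt D a)\<rparr>"

text \<open>The last entry is the only point of the standard 0-simplex.\<close>

definition vertex where
  "vertex D a = cell_class (nerve D) (0, vertex_functor D a, \<lambda>i. if i = 0 then 1 else 0)"

lemma is_functor_vertex_functor:
  assumes "category D" "a \<in> Obj D"
  shows "is_functor (ordinal 0) D (vertex_functor D a)"
proof -
  interpret category D by fact
  have "f \<in> Hom (ordinal 0) i j \<longleftrightarrow> f = (0, 0) \<and> i = 0 \<and> j = 0" for f i j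
    by (auto simp: ordinal_def poset_category_def Hom_def)
  moreover have "Obj (ordinal 0) = {0}" "Arr (ordinal 0) = {(0, 0)}" "Idt (ordinal 0) 0 = (0, 0)"
    "Cmp (ordinal 0) (0, 0) (0, 0) = (0, 0)"
    by (auto simp: ordinal_def poset_category_def)
  ultimately show ?thesis
    using assms by (intro is_functorI) (auto simp: vertex_functor_def Idt_in Cmp_Idt[OF Idt_in])
qed

lemma vertex_in_realization:
  assumes "category D" "a \<in> Obj D"
  shows "vertex D a \<in> topspace (realization (nerve D))"
  using is_functor_vertex_functor[OF assms]
  by (auto simp: vertex_def topspace_realization topspace_cells nerve_def standard_simplex_def)

lemma realization_map_vertex:
  assumes G: "is_functor D E G" and a: "a \<in> Obj D"
  shows "realization_map (nerve E) (nerve_map G) (vertex D a) = vertex E (OMap G a)"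
proof -
  have "nerve_map G 0 (vertex_functor D a) = vertex_functor E (OMap G a)"
    using is_functorD(4)[OF G a]
    by (auto simp: nerve_map_def functor_comp_def vertex_functor_def)
  then show ?thesis by (simp add: vertex_def realization_map_nerve[OF G])
qed

text \<open>Assign to a simplex \<open>F\<close> the value of \<open>v\<close> at its initial
  object. Acting by \<theta> replaces \<open>OMap F 0\<close> by \<open>OMap F (\<theta> 0)\<close>,
  and \<open>F\<close> supplies an arrow from the first to the second, so the value is
  unchanged.\<close>

lemma vertex_path_invariant:
  assumes v: "\<And>f a b. f \<in> Hom D a b \<Longrightarrow> v a = v b"
    and path: "path_component_of (realization (nerve D)) (vertex D a) (vertex D b)"
  shows "v a = v b"
proof -
  have "v (OMap (Act (nerve D) m n \<theta> F) 0) = v (OMap F 0)"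
    if \<theta>: "\<theta> ` {..m} \<subseteq> {..n}" and F: "F \<in> Simp (nerve D) n" for m n \<theta> F
  proof -
    have "\<theta> 0 \<le> n" using \<theta> by auto
    then have "(0, \<theta> 0) \<in> Hom (ordinal n) 0 (\<theta> 0)"
      by (simp add: Hom_def ordinal_def poset_category_def)
    moreover have "is_functor (ordinal n) D F" using F by (simp add: nerve_def)
    ultimately have "v (OMap F 0) = v (OMap F (\<theta> 0))" using v is_functorD(3) by metis
    then show ?thesis
      by (simp add: nerve_def functor_comp_def poset_functor_def ordinal_def poset_category_def)
  qed
  then have "v (OMap (vertex_functor D a) 0) = v (OMap (vertex_functor D b) 0)"
    using realization_path_invariant[of "nerve D" "\<lambda>n F. v (OMap F 0)"] path
    unfolding vertex_def by blast
  then show ?thesis by (simp add: vertex_functor_def ordinal_def poset_category_def)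
qed

lemma restr_vertex:
  assumes "category C" "I \<subseteq> J" "A \<in> Obj (iS C J)"
  shows "restr (iS_space C) J I (vertex (iS C J) A) = vertex (iS C I) (restrict_functor (Ar I) A)"
  using realization_map_vertex[OF is_functor_iS_map[OF assms(1,2)] assms(3)] OMap_iS_map[OF assms(3)]
  by (simp add: restr_def iS_space_def)

lemma restrict_functor_iS:
  assumes "category C" "I \<subseteq> J" "A \<in> Obj (iS C J)"
  shows "restrict_functor (Ar I) A \<in> Obj (iS C I)"
  using is_functor_Obj[OF is_functor_iS_map[OF assms(1,2)] assms(3)] OMap_iS_map[OF assms(3), of I]
  by simp

lemma constant_in_path_space:
  assumes "a \<in> topspace X"
  shows "(\<lambda>s \<in> {0..1}. a) \<in> topspace (path_space X)"
proof -
  have "pathin X (\<lambda>s \<in> {0..1}. a)"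
    unfolding pathin_def using assms by (auto intro: continuous_map_eq[of _ _ "\<lambda>s. a"])
  \<comment> \<open>The generating set with \<open>K\<close> and \<open>U\<close> empty imposes no
    condition on the path.\<close>
  then have "(\<lambda>s \<in> {0..1}. a) \<in> {\<gamma> \<in> extensional {0..1}. pathin X \<gamma> \<and> \<gamma> ` {} \<subseteq> {}}"
    by simp
  then show ?thesis
    unfolding path_space_def topology_generated_by_topspace
    by (rule UnionI[rotated]) (blast intro: compact_empty openin_empty)
qed

section \<open>The 2-Segal map on vertices\<close>

lemma two_segal_map_vertex:
  assumes C: "category C" and P: "P \<subseteq> Pow {..n}" and A: "A \<in> Obj (iS C {..n})"
  shows "two_segal_map n P (iS_space C) (vertex (iS C {..n}) A) =
    ((\<lambda>I \<in> P. vertex (iS C I) (restrict_functor (Ar I) A)),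
     (\<lambda>(I, J) \<in> strict_pairs P. \<lambda>s \<in> {0..1}. vertex (iS C J) (restrict_functor (Ar J) A)))"
  using P by (auto simp: two_segal_map_def strict_pairs_def restr_vertex[OF C _ A] subset_iff intro!: restrict_ext)

text \<open>Supplies the hypothesis \<open>f x \<in> topspace Y\<close> of
  \<open>not_weak_homotopy_equivalence\<close>.\<close>

lemma two_segal_map_vertex_in_holim:
  assumes C: "category C" and P: "P \<subseteq> Pow {..n}" and A: "A \<in> Obj (iS C {..n})"
  shows "two_segal_map n P (iS_space C) (vertex (iS C {..n}) A) \<in> topspace (holim P (iS_space C))"
proof -
  from P have P: "I \<subseteq> {..n}" if "I \<in> P" for I using that by blast
  have v: "vertex (iS C I) (restrict_functor (Ar I) A) \<in> topspace (Level (iS_space C) I)"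
    if "I \<in> P" for I
    using vertex_in_realization[OF category_iS[OF C] restrict_functor_iS[OF C P A]] that
    by (simp add: iS_space_def)
  \<comment> \<open>Restricting in two stages agrees with restricting at once, so the constant paths
    have the required endpoints.\<close>
  have "restr (iS_space C) I J (vertex (iS C I) (restrict_functor (Ar I) A))
      = vertex (iS C J) (restrict_functor (Ar J) A)" if "I \<in> P" "J \<subset> I" for I J
    using that restr_vertex[OF C _ restrict_functor_iS[OF C P A]]
    by (simp add: psubset_imp_subset restrict_functor_Ar)
  then show ?thesis
    unfolding two_segal_map_vertex[OF assms] holim_def
    by (auto simp: v strict_pairs_def constant_in_path_space)
qed


section \<open>Finite pointed sets\<close>

text \<open>A number codes a finite set of numbers with base point \<open>0\<close>; \<open>pset\<close> is not injective.\<close>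

definition pset :: "nat \<Rightarrow> nat set" where
  "pset a = insert 0 (set_decode a)"

lemma finite_pset: "finite (pset a)"
  by (simp add: pset_def)

lemma zero_in_pset [simp]: "0 \<in> pset a"
  by (simp add: pset_def)

lemma pset_0: "pset 0 = {0}"
  by (simp add: pset_def)

lemma pset_surj:
  assumes "finite S" "0 \<in> S"
  obtains a where "pset a = S"
  using assms by (metis pset_def set_encode_inverse insert_absorb)

definition pmaps :: "nat \<Rightarrow> nat \<Rightarrow> (nat \<Rightarrow> nat) set" where
  "pmaps b a = {f \<in> pset b \<rightarrow>\<^sub>E pset a. f 0 = 0}"

text \<open>The endpoints are stored with the map, since an extensional function determines neither
  its codomain nor, \<open>pset\<close> not being injective, the code of its domain.\<close>

definition pmap_triples :: "(nat \<times> nat \<times> (nat \<Rightarrow> nat)) set" where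
  "pmap_triples = {(a, b, f). f \<in> pmaps b a}"

text \<open>There are countably many pairs of endpoints and finitely many maps for each.
  Countability is what allows arrows to be coded by natural numbers.\<close>

lemma countable_pmap_triples: "countable pmap_triples"
proof -
  have "countable (pmaps b a)" for a b
    by (rule countable_subset[OF _ countable_finite[OF finite_PiE[OF finite_pset finite_pset]]])
      (auto simp: pmaps_def)
  then have "countable (SIGMA a:UNIV. SIGMA b:UNIV. pmaps b a)" by auto
  then show ?thesis by (rule countable_subset[rotated]) (auto simp: pmap_triples_def)
qed

definition mk_arr :: "nat \<Rightarrow> nat \<Rightarrow> (nat \<Rightarrow> nat) \<Rightarrow> nat" where
  "mk_arr a b f = to_nat_on pmap_triples (a, b, f)"

definition dest_arr :: "nat \<Rightarrow> nat \<times> nat \<times> (nat \<Rightarrow> nat)" where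
  "dest_arr = from_nat_into pmap_triples"

lemma dest_mk_arr: "f \<in> pmaps b a \<Longrightarrow> dest_arr (mk_arr a b f) = (a, b, f)"
  unfolding dest_arr_def mk_arr_def
  by (intro from_nat_into_to_nat_on countable_pmap_triples) (simp add: pmap_triples_def)

text \<open>An arrow \<open>a \<rightarrow> b\<close> is the code of a pointed map \<open>pset b \<rightarrow> pset a\<close>.\<close>

definition FinPset_op :: "(nat, nat) cof_category" where
  "FinPset_op =
    \<lparr>Obj = UNIV,
     Arr = {mk_arr a b f |a b f. f \<in> pmaps b a},
     Dom = (\<lambda>m. fst (dest_arr m)),
     Cod = (\<lambda>m. fst (snd (dest_arr m))),
     Idt = (\<lambda>a. mk_arr a a (\<lambda>x \<in> pset a. x)),
     Cmp = (\<lambda>m' m. mk_arr (fst (dest_arr m)) (fst (snd (dest_arr m')))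
       (compose (pset (fst (snd (dest_arr m')))) (snd (snd (dest_arr m))) (snd (snd (dest_arr m'))))),
     Zero = 0,
     Cof = {mk_arr a b f |a b f. f \<in> pmaps b a}\<rparr>"

lemma Hom_FinPset_op: "m \<in> Hom FinPset_op a b \<longleftrightarrow> (\<exists>f \<in> pmaps b a. m = mk_arr a b f)"
  by (auto simp: Hom_def FinPset_op_def dest_mk_arr)

lemma Cmp_FinPset_op:
  "\<lbrakk>f \<in> pmaps b a; g \<in> pmaps c b\<rbrakk>
    \<Longrightarrow> Cmp FinPset_op (mk_arr b c g) (mk_arr a b f) = mk_arr a c (compose (pset c) f g)"
  by (simp add: FinPset_op_def dest_mk_arr)

lemma mk_arr_inject: "\<lbrakk>f \<in> pmaps b a; g \<in> pmaps b a\<rbrakk> \<Longrightarrow> mk_arr a b f = mk_arr a b g \<longleftrightarrow> f = g"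
  using dest_mk_arr by (metis prod.inject)

lemma compose_pmaps: "\<lbrakk>f \<in> pmaps b a; g \<in> pmaps c b\<rbrakk> \<Longrightarrow> compose (pset c) f g \<in> pmaps c a"
  by (auto simp: pmaps_def compose_def)

lemma pmaps_in: "\<lbrakk>f \<in> pmaps b a; x \<in> pset b\<rbrakk> \<Longrightarrow> f x \<in> pset a"
  by (auto simp: pmaps_def)

lemma pmaps_ext: "\<lbrakk>f \<in> pmaps b a; g \<in> pmaps b a; \<And>x. x \<in> pset b \<Longrightarrow> f x = g x\<rbrakk> \<Longrightarrow> f = g"
  by (auto simp: pmaps_def intro: PiE_ext)

lemma id_pmaps: "(\<lambda>x \<in> pset a. x) \<in> pmaps a a"
  by (auto simp: pmaps_def)

lemma category_FinPset_op: "category FinPset_op"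
proof
  fix m assume "m \<in> Arr FinPset_op"
  then show "Dom FinPset_op m \<in> Obj FinPset_op" "Cod FinPset_op m \<in> Obj FinPset_op"
    by (simp_all add: FinPset_op_def)
next
  have Idt: "Idt FinPset_op a = mk_arr a a (\<lambda>x \<in> pset a. x)" for a
    by (simp add: FinPset_op_def)
  show "Idt FinPset_op a \<in> Hom FinPset_op a a" for a
    unfolding Hom_FinPset_op Idt using id_pmaps by blast
  fix m a b assume "m \<in> Hom FinPset_op a b"
  then obtain f where f: "f \<in> pmaps b a" "m = mk_arr a b f" by (auto simp: Hom_FinPset_op)
  have "compose (pset b) (\<lambda>x \<in> pset a. x) f = f" "compose (pset b) f (\<lambda>x \<in> pset b. x) = f"
    using f pmaps_in[OF f(1)]
    by (auto intro!: pmaps_ext[of _ b a] compose_pmaps id_pmaps simp: compose_eq)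
  then show "Cmp FinPset_op m (Idt FinPset_op a) = m" "Cmp FinPset_op (Idt FinPset_op b) m = m"
    by (simp_all add: f Idt Cmp_FinPset_op id_pmaps)
  fix m' c assume "m' \<in> Hom FinPset_op b c"
  then obtain g where g: "g \<in> pmaps c b" "m' = mk_arr b c g" by (auto simp: Hom_FinPset_op)
  show "Cmp FinPset_op m' m \<in> Hom FinPset_op a c"
    unfolding f g Cmp_FinPset_op[OF f(1) g(1)] Hom_FinPset_op
    using compose_pmaps[OF f(1) g(1)] by blast
  fix m'' d assume "m'' \<in> Hom FinPset_op c d"
  then obtain h where h: "h \<in> pmaps d c" "m'' = mk_arr c d h" by (auto simp: Hom_FinPset_op)
  have "compose (pset d) (compose (pset c) f g) h = compose (pset d) f (compose (pset d) g h)"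
    using pmaps_in[OF h(1)] by (auto simp: compose_def)
  then show "Cmp FinPset_op m'' (Cmp FinPset_op m' m) = Cmp FinPset_op (Cmp FinPset_op m'' m') m"
    using compose_pmaps[OF f(1) g(1)] compose_pmaps[OF g(1) h(1)]
    by (simp add: f g h Cmp_FinPset_op)
qed

text \<open>On a zero object the identity and the map constant at the base point coincide.
  Conversely every pointed map into or out of a one-point set is constant at the base point.\<close>

lemma zero_object_FinPset_op: "is_zero_object FinPset_op a \<longleftrightarrow> pset a = {0}"
proof
  assume z: "is_zero_object FinPset_op a"
  then have "\<exists>!m. m \<in> Hom FinPset_op a a" by (simp add: is_zero_object_def)
  moreover have 0: "(\<lambda>x \<in> pset a. 0) \<in> pmaps a a" by (auto simp: pmaps_def)
  ultimately have "mk_arr a a (\<lambda>x \<in> pset a. x) = mk_arr a a (\<lambda>x \<in> pset a. 0)"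
    using id_pmaps by (auto simp: Hom_FinPset_op)
  then have eq: "(\<lambda>x \<in> pset a. x) = (\<lambda>x \<in> pset a. 0)" by (simp add: mk_arr_inject 0 id_pmaps)
  have "x = 0" if "x \<in> pset a" for x using fun_cong[OF eq, of x] that by simp
  then show "pset a = {0}" using zero_in_pset by blast
next
  assume a: "pset a = {0}"
  have 0: "(\<lambda>x \<in> pset b. 0) \<in> pmaps b c" for b c by (auto simp: pmaps_def)
  have "f = (\<lambda>x \<in> pset b. 0)" if "f \<in> pmaps b a" for f b
    using pmaps_in[OF that] a by (intro pmaps_ext[OF that 0]) auto
  moreover have "f = (\<lambda>x \<in> pset a. 0)" if "f \<in> pmaps a b" for f b
    using that by (intro pmaps_ext[OF that 0]) (auto simp: a pmaps_def)
  ultimately show "is_zero_object FinPset_op a"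
    unfolding is_zero_object_def Hom_FinPset_op using 0
    by (auto simp: FinPset_op_def intro!: ex1I)
qed

lemma pushout_FinPset_op:
  assumes m: "m \<in> Hom FinPset_op a b" and m': "m' \<in> Hom FinPset_op a c"
  shows "\<exists>h k. is_pushout FinPset_op m m' h k"
proof -
  obtain f where f: "f \<in> pmaps b a" "m = mk_arr a b f" using m by (auto simp: Hom_FinPset_op)
  obtain g where g: "g \<in> pmaps c a" "m' = mk_arr a c g" using m' by (auto simp: Hom_FinPset_op)
  \<comment> \<open>The fibre product of \<open>f\<close> and \<open>g\<close>, with pairs coded as
    numbers. The base point \<open>(0, 0)\<close> has code 0, so that \<open>S\<close> is a value of
    \<open>pset\<close>.\<close>
  define S where "S = prod_encode ` {(y, z). y \<in> pset b \<and> z \<in> pset c \<and> f y = g z}"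
  have enc0: "prod_encode (0, 0) = 0" by (simp add: prod_encode_def)
  have "finite S" unfolding S_def
    by (rule finite_imageI, rule finite_subset[of _ "pset b \<times> pset c"]) (auto simp: finite_pset)
  moreover have "0 \<in> S" unfolding S_def using enc0 f g
    by (intro image_eqI[of _ _ "(0, 0)"]) (auto simp: pmaps_def)
  ultimately obtain p where p: "pset p = S" by (rule pset_surj)
  define h where "h = (\<lambda>x \<in> pset p. fst (prod_decode x))"
  define k where "k = (\<lambda>x \<in> pset p. snd (prod_decode x))"
  have dec0: "prod_decode 0 = (0, 0)" by (metis enc0 prod_encode_inverse)
  have mem: "fst (prod_decode x) \<in> pset b" "snd (prod_decode x) \<in> pset c"
    "f (fst (prod_decode x)) = g (snd (prod_decode x))" if "x \<in> pset p" for x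
    using that by (auto simp: p S_def)
  have hk: "h \<in> pmaps p b" "k \<in> pmaps p c" "compose (pset p) f h = compose (pset p) g k"
    by (auto simp: h_def k_def pmaps_def compose_def mem dec0 intro!: restrict_ext)
  have "\<exists>!w. w \<in> Hom FinPset_op p q \<and> Cmp FinPset_op w (mk_arr b p h) = U \<and>
      Cmp FinPset_op w (mk_arr c p k) = V"
    if U: "U \<in> Hom FinPset_op b q" and V: "V \<in> Hom FinPset_op c q"
      and UV: "Cmp FinPset_op U m = Cmp FinPset_op V m'" for q U V
  proof -
    obtain u where u: "u \<in> pmaps q b" "U = mk_arr b q u" using U by (auto simp: Hom_FinPset_op)
    obtain v where v: "v \<in> pmaps q c" "V = mk_arr c q v" using V by (auto simp: Hom_FinPset_op)
    have "compose (pset q) f u = compose (pset q) g v"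
      using UV f g u v by (simp add: Cmp_FinPset_op mk_arr_inject compose_pmaps)
    then have uv: "f (u x) = g (v x)" if "x \<in> pset q" for x
      using that by (metis compose_eq)
    \<comment> \<open>The map into the fibre product with coordinates \<open>u\<close> and
      \<open>v\<close>.\<close>
    define w where "w = (\<lambda>x \<in> pset q. prod_encode (u x, v x))"
    have w: "w \<in> pmaps q p"
      using u v uv pmaps_in[OF u(1)] pmaps_in[OF v(1)]
      by (auto simp: pmaps_def w_def p S_def enc0)
    have "w x \<in> pset p" if "x \<in> pset q" for x using w that by (rule pmaps_in)
    then have hw: "compose (pset q) h w = u" and kw: "compose (pset q) k w = v"
      using u v hk w
      by (auto intro!: pmaps_ext[OF compose_pmaps] simp: compose_eq h_def k_def w_def)
    \<comment> \<open>Composing with \<open>h\<close> and \<open>k\<close> yields both coordinates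
      of \<open>w'\<close>, which determine it.\<close>
    have uniq: "w' = w" if w': "w' \<in> pmaps q p"
      "compose (pset q) h w' = u" "compose (pset q) k w' = v" for w'
    proof (rule pmaps_ext[OF w'(1) w])
      fix x assume x: "x \<in> pset q"
      have "w' x \<in> pset p" using w'(1) x by (rule pmaps_in)
      then have "fst (prod_decode (w' x)) = u x" "snd (prod_decode (w' x)) = v x"
        using x fun_cong[OF w'(2), of x] fun_cong[OF w'(3), of x] by (simp_all add: compose_def h_def k_def)
      then have "prod_decode (w' x) = (u x, v x)" by (simp add: prod_eq_iff)
      then show "w' x = w x" using x by (metis prod_decode_inverse restrict_apply' w_def)
    qed
    show ?thesis
    proof (rule ex1I[of _ "mk_arr p q w"])
      show "mk_arr p q w \<in> Hom FinPset_op p q \<and> Cmp FinPset_op (mk_arr p q w) (mk_arr b p h) = U \<and>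
          Cmp FinPset_op (mk_arr p q w) (mk_arr c p k) = V"
        using w by (auto simp: Hom_FinPset_op Cmp_FinPset_op[OF hk(1) w] Cmp_FinPset_op[OF hk(2) w] hw kw u v)
      fix W assume W: "W \<in> Hom FinPset_op p q \<and> Cmp FinPset_op W (mk_arr b p h) = U \<and>
          Cmp FinPset_op W (mk_arr c p k) = V"
      then obtain w' where w': "w' \<in> pmaps q p" "W = mk_arr p q w'" by (auto simp: Hom_FinPset_op)
      have "w' = w"
        using W by (intro uniq w'(1))
          (simp_all add: w'(2) u(2) v(2) Cmp_FinPset_op[OF hk(1) w'(1)] Cmp_FinPset_op[OF hk(2) w'(1)]
            mk_arr_inject[OF compose_pmaps[OF hk(1) w'(1)] u(1)] mk_arr_inject[OF compose_pmaps[OF hk(2) w'(1)] v(1)])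
      then show "W = mk_arr p q w" by (simp add: w')
    qed
  qed
  moreover have "Cmp FinPset_op (mk_arr b p h) m = Cmp FinPset_op (mk_arr c p k) m'"
    using f g hk by (simp add: Cmp_FinPset_op)
  moreover have "mk_arr b p h \<in> Hom FinPset_op b p" "mk_arr c p k \<in> Hom FinPset_op c p"
    using hk by (auto simp: Hom_FinPset_op)
  ultimately have "is_pushout FinPset_op m m' (mk_arr b p h) (mk_arr c p k)"
    unfolding is_pushout_def using m m' by (intro exI[of _ a] exI[of _ b] exI[of _ c] exI[of _ p]) simp
  then show ?thesis by blast
qed

text \<open>Every arrow is a cofibration, so the closure conditions are automatic; the content lies
  in the zero object and the existence of pushouts.\<close>

lemma cofibrations_FinPset_op: "category_with_cofibrations FinPset_op"
proof -
  interpret category FinPset_op by (rule category_FinPset_op)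
  have Cof: "Cof FinPset_op = Arr FinPset_op" by (simp add: FinPset_op_def)
  show ?thesis
  proof
    show "is_zero_object FinPset_op (Zero FinPset_op)"
      by (simp add: zero_object_FinPset_op) (simp add: FinPset_op_def pset_0)
    show "Cmp FinPset_op g f \<in> Cof FinPset_op"
      if "f \<in> Cof FinPset_op" "g \<in> Cof FinPset_op" "Cod FinPset_op f = Dom FinPset_op g" for f g
      using that Cmp_in[of f "Dom FinPset_op f" "Cod FinPset_op f" g "Cod FinPset_op g"]
      by (simp add: Cof Hom_def)
    show "\<exists>h k. is_pushout FinPset_op f g h k \<and> k \<in> Cof FinPset_op"
      if "f \<in> Cof FinPset_op" "g \<in> Arr FinPset_op" "Dom FinPset_op g = Dom FinPset_op f" for f g
    proof -
      have "f \<in> Hom FinPset_op (Dom FinPset_op f) (Cod FinPset_op f)"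
        "g \<in> Hom FinPset_op (Dom FinPset_op f) (Cod FinPset_op g)"
        using that by (auto simp: Cof Hom_def)
      then obtain h k where hk: "is_pushout FinPset_op f g h k" using pushout_FinPset_op by blast
      then have "k \<in> Arr FinPset_op" by (auto simp: is_pushout_def Hom_def)
      with hk show ?thesis by (auto simp: Cof)
    qed
  qed (auto simp: Cof Hom_def is_iso_def)
qed


section \<open>Step functors\<close>

text \<open>The places where the object \<open>x\<^sub>m\<close> takes the value \<open>a\<close>.
  The condition \<open>0 < snd p\<close> keeps the diagonal entry at \<open>(0, 0)\<close>
  zero.\<close>

definition step_supp :: "nat \<Rightarrow> nat \<times> nat \<Rightarrow> bool" where
  "step_supp m p \<longleftrightarrow> fst p = 0 \<and> 0 < snd p \<and> snd p \<le> m"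

definition step_obj where
  "step_obj C a m p = (if step_supp m p then a else Zero C)"

text \<open>If \<open>p\<close> or \<open>q\<close> is outside the support, one end is the zero
  object and the description picks the only arrow there is.\<close>

definition step_arr where
  "step_arr C a m p q = (if step_supp m p \<and> step_supp m q then Idt C a
     else (THE f. f \<in> Hom C (step_obj C a m p) (step_obj C a m q)))"

definition step_functor where
  "step_functor C a m I =
    \<lparr>OMap = restrict (step_obj C a m) (Obj (Ar I)),
     MMap = (\<lambda>(p, q) \<in> Arr (Ar I). step_arr C a m p q)\<rparr>"

context category_with_cofibrations
begin

lemma Zero_Obj: "Zero C \<in> Obj C"
  using Zero_zero by (simp add: is_zero_object_def)

lemma step_obj_Obj: "a \<in> Obj C \<Longrightarrow> step_obj C a m p \<in> Obj C"
  by (simp add: step_obj_def Zero_Obj)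

lemma step_Hom_ex1:
  assumes "a \<in> Obj C" "\<not> (step_supp m p \<and> step_supp m q)"
  shows "\<exists>!f. f \<in> Hom C (step_obj C a m p) (step_obj C a m q)"
  using assms Zero_zero Zero_Obj unfolding is_zero_object_def
  by (cases "step_supp m p"; cases "step_supp m q") (simp_all add: step_obj_def)

lemma step_arr_Hom:
  assumes a: "a \<in> Obj C"
  shows "step_arr C a m p q \<in> Hom C (step_obj C a m p) (step_obj C a m q)"
proof (cases "step_supp m p \<and> step_supp m q")
  case True
  then show ?thesis using a by (simp add: step_arr_def step_obj_def Idt_in)
next
  case False
  then show ?thesis using theI'[OF step_Hom_ex1[OF a False]] by (auto simp: step_arr_def)
qed

text \<open>Arrows into or out of zero are forced, so equations of arrows need checking only between
  places of the support.\<close>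

lemma step_arr_eqI:
  assumes a: "a \<in> Obj C" and f: "f \<in> Hom C (step_obj C a m p) (step_obj C a m q)"
    and "\<lbrakk>step_supp m p; step_supp m q\<rbrakk> \<Longrightarrow> f = Idt C a"
  shows "step_arr C a m p q = f"
proof (cases "step_supp m p \<and> step_supp m q")
  case True
  then show ?thesis using assms by (simp add: step_arr_def)
next
  case False
  then show ?thesis using step_Hom_ex1[OF a False] f step_arr_Hom[OF a, of m p q] by auto
qed

lemma is_functor_step_functor:
  assumes a: "a \<in> Obj C"
  shows "is_functor (Ar I) C (step_functor C a m I)"
proof -
  interpret Ar: category "Ar I" by (rule category_Ar)
  have Hom: "f \<in> Hom (Ar I) p q \<longleftrightarrow> f = (p, q) \<and> (p, q) \<in> Arr (Ar I)" for f p q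
    by (auto simp: Hom_def Ar_def poset_category_def)
  have Idt: "Idt (Ar I) p = (p, p)" and Cmp: "Cmp (Ar I) (q, r) (p, q) = (p, r)" for p q r
    by (simp_all add: Ar_def poset_category_def)
  show ?thesis
  proof (rule is_functorI)
    fix p assume "p \<in> Obj (Ar I)"
    then show "MMap (step_functor C a m I) (Idt (Ar I) p) = Idt C (OMap (step_functor C a m I) p)"
      using Ar.Idt_in[of p] a
      by (auto simp: Idt Hom step_functor_def Idt_in Zero_Obj step_obj_Obj step_obj_def
          intro!: step_arr_eqI)
  next
    fix f g p q r assume fg: "f \<in> Hom (Ar I) p q" "g \<in> Hom (Ar I) q r"
    have "step_arr C a m p r = Cmp C (step_arr C a m q r) (step_arr C a m p q)"
    proof (rule step_arr_eqI[OF a Cmp_in[OF step_arr_Hom[OF a] step_arr_Hom[OF a]]])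
      assume pr: "step_supp m p" "step_supp m r"
      \<comment> \<open>The support is convex: if \<open>p \<le> q \<le> r\<close> with
        \<open>p\<close> and \<open>r\<close> in it, then \<open>fst q = 0\<close> and
        \<open>snd q\<close> lies between \<open>snd p\<close> and \<open>snd r\<close>.\<close>
      then have "step_supp m q" using fg by (auto simp: Hom Arr_Ar step_supp_def)
      then show "Cmp C (step_arr C a m q r) (step_arr C a m p q) = Idt C a"
        using pr Cmp_Idt[OF Idt_in[OF a]] by (simp add: step_arr_def)
    qed
    then show "MMap (step_functor C a m I) (Cmp (Ar I) g f)
        = Cmp C (MMap (step_functor C a m I) g) (MMap (step_functor C a m I) f)"
      using fg Ar.Cmp_in[OF fg] by (auto simp: Hom Cmp step_functor_def)
  next
    fix f p q assume "f \<in> Hom (Ar I) p q"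
    then show "MMap (step_functor C a m I) f
        \<in> Hom C (OMap (step_functor C a m I) p) (OMap (step_functor C a m I) q)"
      by (auto simp: Hom step_functor_def Arr_Ar step_arr_Hom[OF a])
  qed (simp_all add: step_functor_def step_obj_Obj a)
qed

text \<open>The cokernel of an identity is 0, and so is that of any arrow to 0. The mediating arrow
  is always \<open>V\<close>, and it is unique because it starts at 0.\<close>

lemma cofibration_sequence_to_Zero:
  assumes f: "f \<in> Hom C a b" "f \<in> Cof C" and g: "g \<in> Hom C b (Zero C)"
    and triv: "b = Zero C \<or> a = b \<and> f = Idt C b"
  shows "cofibration_sequence C f g"
proof -
  note ZD = zero_objectD[OF Zero_zero]
  note ab = Hom_Obj[OF f(1)]
  obtain u where u: "u \<in> Hom C a (Zero C)" using ZD(2)[OF ab(1)] ..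
  let ?v = "Idt C (Zero C)"
  have v: "?v \<in> Hom C (Zero C) (Zero C)" by (rule Idt_in[OF Zero_Obj])
  have "is_pushout C f u g ?v"
    unfolding is_pushout_def
  proof (intro exI conjI allI ballI impI)
    show "Cmp C g f = Cmp C ?v u"
      by (rule ZD(4)[OF ab(1) Cmp_in[OF f(1) g] Cmp_in[OF u v]])
    fix q U V
    assume U: "U \<in> Hom C b q" and V: "V \<in> Hom C (Zero C) q" and UV: "Cmp C U f = Cmp C V u"
    have q: "q \<in> Obj C" using Hom_Obj[OF U] by simp
    have "Cmp C V g = U"
      using triv
    proof
      assume "b = Zero C"
      then show ?thesis using ZD(3)[OF q] Cmp_in[OF g V] U by simp
    next
      assume *: "a = b \<and> f = Idt C b"
      then have "u = g" using ZD(4)[OF ab(2)] u g by simp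
      then show ?thesis using * UV Cmp_Idt[OF U] by simp
    qed
    then have "V \<in> Hom C (Zero C) q \<and> Cmp C V g = U \<and> Cmp C V ?v = V"
      using V Cmp_Idt[OF V] by simp
    then show "\<exists>!w. w \<in> Hom C (Zero C) q \<and> Cmp C w g = U \<and> Cmp C w ?v = V"
      by (rule ex1I[of _ V]) (rule ZD(3)[OF q conjunct1 V])
  qed (fact f u g v)+
  then show ?thesis
    unfolding cofibration_sequence_def using f u v HomD[OF f(1)] HomD[OF g] by auto
qed

lemma step_functor_iS:
  assumes a: "a \<in> Obj C" and Cof: "Cof C = Arr C"
  shows "step_functor C a m I \<in> Obj (iS C I)"
proof -
  have "cofibration_sequence C (step_arr C a m (i, j) (i, k)) (step_arr C a m (i, k) (j, k))"
    if "i < j" "j < k" for i j k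
  proof (rule cofibration_sequence_to_Zero)
    show "step_arr C a m (i, j) (i, k) \<in> Hom C (step_obj C a m (i, j)) (step_obj C a m (i, k))"
      by (rule step_arr_Hom[OF a])
    then show "step_arr C a m (i, j) (i, k) \<in> Cof C" by (simp add: Cof HomD(1))
    \<comment> \<open>From \<open>i < j\<close> follows \<open>0 < j\<close>, so every quotient is
      zero.\<close>
    have "step_obj C a m (j, k) = Zero C" using that by (simp add: step_obj_def step_supp_def)
    then show "step_arr C a m (i, k) (j, k) \<in> Hom C (step_obj C a m (i, k)) (Zero C)"
      using step_arr_Hom[OF a, of m "(i, k)" "(j, k)"] by simp
    \<comment> \<open>If \<open>i = 0\<close> and \<open>k \<le> m\<close>, then
      \<open>(0, j)\<close> is in the support as well and the arrow is the identity of
      \<open>a\<close>; otherwise the middle term is zero.\<close>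
    show "step_obj C a m (i, k) = Zero C \<or> step_obj C a m (i, j) = step_obj C a m (i, k) \<and>
        step_arr C a m (i, j) (i, k) = Idt C (step_obj C a m (i, k))"
      using that by (auto simp: step_obj_def step_supp_def step_arr_def)
  qed
  then show ?thesis
    using is_functor_step_functor[OF a]
    by (auto simp: iS_def core_def S_cat_def full_subcategory_def functor_category_def
        step_functor_def Obj_Ar Arr_Ar step_obj_def step_supp_def)
qed

end

lemma restrict_step_functor:
  assumes "I \<subseteq> J"
  shows "restrict_functor (Ar I) (step_functor C a m J) = step_functor C a m I"
proof -
  have "Obj (Ar J) \<inter> Obj (Ar I) = Obj (Ar I)" "Arr (Ar J) \<inter> Arr (Ar I) = Arr (Ar I)"
    using assms by (auto simp: Obj_Ar Arr_Ar)
  then show ?thesis by (simp add: restrict_functor_def step_functor_def)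
qed

text \<open>The parameter \<open>m\<close> is seen only by pairs \<open>(0, b)\<close> with
  \<open>0 < b\<close>.\<close>

lemma step_functor_cong:
  assumes "\<And>b. \<lbrakk>0 \<in> I; b \<in> I; 0 < b\<rbrakk> \<Longrightarrow> b \<le> m \<longleftrightarrow> b \<le> m'"
  shows "step_functor C a m I = step_functor C a m' I"
proof -
  have "step_supp m p = step_supp m' p" if "p \<in> Obj (Ar I)" for p
    using that assms by (cases p) (auto simp: Obj_Ar step_supp_def)
  then have "step_obj C a m p = step_obj C a m' p" "p \<in> Obj (Ar I) \<Longrightarrow> step_supp m p = step_supp m' p"
    if "p \<in> Obj (Ar I)" for p
    using that by (simp_all add: step_obj_def)
  then show ?thesis
    by (auto simp: step_functor_def step_arr_def Arr_Ar intro!: restrict_ext)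
qed

text \<open>Whether the entry at \<open>(0, j)\<close> is zero is constant on path components. This
  entry is 0 for the parameter \<open>i\<close>, since \<open>i < j\<close>, and \<open>a\<close>
  for the parameter \<open>j\<close>.\<close>

lemma step_functors_not_connected:
  assumes C: "category_with_cofibrations C" and a: "\<not> is_zero_object C a" and "0 \<in> I" "j \<in> I" "i < j"
  shows "\<not> path_component_of (realization (nerve (iS C I)))
    (vertex (iS C I) (step_functor C a i I)) (vertex (iS C I) (step_functor C a j I))"
proof
  interpret category_with_cofibrations C by fact
  let ?v = "\<lambda>A. is_zero_object C (OMap A (0, j))"
  have 0: "(0, j) \<in> Obj (Ar I)" using assms by (simp add: Obj_Ar)
  assume "path_component_of (realization (nerve (iS C I)))
    (vertex (iS C I) (step_functor C a i I)) (vertex (iS C I) (step_functor C a j I))"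
  then have "?v (step_functor C a i I) = ?v (step_functor C a j I)"
  proof (rule vertex_path_invariant[rotated])
    fix \<alpha> A B assume "\<alpha> \<in> Hom (iS C I) A B"
    then obtain f where f: "f \<in> Hom C (OMap A (0, j)) (OMap B (0, j))" "is_iso C f"
      using iS_Hom_components[OF category_axioms _ 0] by (metis prod_cases3)
    then show "?v A = ?v B" by (rule zero_object_iso_iff)
  qed
  then show False
    using a Zero_zero 0 \<open>i < j\<close> by (simp add: step_functor_def step_obj_def step_supp_def)
qed


section \<open>Crossing chords\<close>

text \<open>The line through \<open>cis \<alpha>\<close> and \<open>cis \<gamma>\<close> separates 1
  from \<open>cis \<beta>\<close>, so the open segment meets the line; the meeting point lies in the
  unit disc, and the disc cuts the line in the chord.\<close>

lemma chords_cross: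
  fixes \<alpha> \<beta> \<gamma> :: real
  assumes "0 < \<alpha>" "\<alpha> < \<beta>" "\<beta> < \<gamma>" "\<gamma> < 2 * pi"
  shows "open_segment 1 (cis \<beta>) \<inter> closed_segment (cis \<alpha>) (cis \<gamma>) \<noteq> {}"
proof -
  \<comment> \<open>The chord is perpendicular to the direction \<mu>; its ends are at angle
    \<delta> on either side.\<close>
  define \<mu> \<delta> where "\<mu> = (\<alpha> + \<gamma>) / 2" and "\<delta> = (\<gamma> - \<alpha>) / 2"
  \<comment> \<open>After rotation by \<open>- \<mu>\<close> the chord lies on the vertical line
    with real part \<open>cos \<delta>\<close>; \<open>L\<close> is the signed distance from
    it.\<close>
  define L where "L = (\<lambda>z. Re (z * cis (- \<mu>)) - cos \<delta>)"
  have \<delta>: "0 < \<delta>" "\<delta> < pi" and ag: "\<alpha> = \<mu> - \<delta>" "\<gamma> = \<mu> + \<delta>"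
    using assms by (auto simp: \<mu>_def \<delta>_def field_simps)
  have "L 1 = cos \<mu> - cos \<delta>" by (simp add: L_def)
  also have "\<dots> = 2 * sin ((\<mu> + \<delta>) / 2) * sin ((\<delta> - \<mu>) / 2)" by (rule cos_diff_cos)
  also have "(\<mu> + \<delta>) / 2 = \<gamma> / 2" by (simp add: ag)
  also have "(\<delta> - \<mu>) / 2 = - (\<alpha> / 2)" by (simp add: ag field_simps)
  finally have "L 1 = - (2 * sin (\<gamma> / 2) * sin (\<alpha> / 2))" by simp
  moreover have "sin (\<gamma> / 2) > 0" "sin (\<alpha> / 2) > 0"
    using assms by (auto intro!: sin_gt_zero)
  ultimately have L1: "L 1 < 0" by simp
  \<comment> \<open>The angle \<beta> is closer to \<mu> than \<delta>, and cosine decreases on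
    \<open>[0, pi]\<close>.\<close>
  have "cos \<delta> < cos \<bar>\<beta> - \<mu>\<bar>"
    using assms \<delta> by (intro cos_monotone_0_pi) (auto simp: \<mu>_def \<delta>_def abs_if field_simps)
  then have Lb: "L (cis \<beta>) > 0" by (simp add: L_def cis_mult abs_if cos_diff mult.commute split: if_splits)
  \<comment> \<open>The zero of the affine function \<open>L\<close> along the segment from 1 to
    \<open>cis \<beta>\<close>.\<close>
  define u where "u = - L 1 / (L (cis \<beta>) - L 1)"
  have u: "0 < u" "u < 1" using L1 Lb by (auto simp: u_def field_simps)
  define x where "x = (1 - u) *\<^sub>R 1 + u *\<^sub>R cis \<beta>"
  have "L x = (1 - u) * L 1 + u * L (cis \<beta>)"
    by (simp add: L_def x_def algebra_simps)
  also have "\<dots> = L 1 + u * (L (cis \<beta>) - L 1)" by (simp add: algebra_simps)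
  also have "\<dots> = 0" using L1 Lb by (simp add: u_def)
  finally have Lx: "L x = 0" .
  have "1 \<noteq> cis \<beta>" using L1 Lb by auto
  then have x1: "x \<in> open_segment 1 (cis \<beta>)" using u by (auto simp: x_def in_segment)
  have "x \<in> convex hull {1, cis \<beta>}" using x1
    by (auto simp: open_segment_def segment_convex_hull)
  also have "\<dots> \<subseteq> cball 0 1" by (rule hull_minimal) auto
  finally have nx: "norm x \<le> 1" by simp
  define w where "w = x * cis (- \<mu>)"
  have x_w: "x = w * cis \<mu>" by (simp add: w_def cis_mult mult.assoc)
  have Rew: "Re w = cos \<delta>" using Lx by (simp add: L_def w_def)
  have "norm w \<le> 1" using nx by (simp add: w_def norm_mult)
  then have "(norm w)\<^sup>2 \<le> 1" by (simp add: power_le_one)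
  \<comment> \<open>The real part is \<open>cos \<delta>\<close> and the norm at most 1.\<close>
  then have "(Im w)\<^sup>2 \<le> (sin \<delta>)\<^sup>2"
    using Rew by (simp add: cmod_power2 sin_squared_eq)
  moreover have s: "sin \<delta> > 0" using \<delta> by (rule sin_gt_zero)
  ultimately have Imw: "\<bar>Im w\<bar> \<le> sin \<delta>" by (simp add: abs_le_square_iff[symmetric])
  \<comment> \<open>The solution of \<open>(2 * t - 1) * sin \<delta> = Im w\<close>, the position
    of \<open>w\<close> between \<open>cis (- \<delta>)\<close> and
    \<open>cis \<delta>\<close>.\<close>
  define t where "t = (1 + Im w / sin \<delta>) / 2"
  have t: "0 \<le> t" "t \<le> 1" using Imw s by (auto simp: t_def field_simps abs_le_iff)
  have w: "w = (1 - t) *\<^sub>R cis (- \<delta>) + t *\<^sub>R cis \<delta>"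
    using s by (intro complex_eqI) (simp_all add: Rew t_def field_simps)
  have "x = (1 - t) *\<^sub>R (cis (- \<delta>) * cis \<mu>) + t *\<^sub>R (cis \<delta> * cis \<mu>)"
    by (simp only: x_w w distrib_right mult_scaleR_left)
  then have "x = (1 - t) *\<^sub>R cis \<alpha> + t *\<^sub>R cis \<gamma>"
    by (simp add: cis_mult ag add.commute)
  with t have "x \<in> closed_segment (cis \<alpha>) (cis \<gamma>)" by (auto simp: in_segment)
  with x1 show ?thesis by blast
qed

text \<open>Vertex 0 is the point 1, and all other vertices lie in the open half-plane of real part
  less than 1, which is convex.\<close>

lemma polygon_hull_no_zero:
  assumes "I \<subseteq> {..n}" "0 \<notin> I"
  shows "polygon_vertex n 0 \<notin> polygon_hull n I"
proof -
  have "polygon_hull n I \<subseteq> {z. Re z < 1}"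
    unfolding polygon_hull_def
  proof (rule hull_minimal)
    show "polygon_vertex n ` I \<subseteq> {z. Re z < 1}"
    proof clarify
      fix k assume "k \<in> I"
      with assms have k: "0 < k" "k < n + 1" by (auto simp: Suc_le_eq intro: gr0I)
      \<comment> \<open>Half the angle of vertex \<open>k\<close>, for the formula
        \<open>cos (2 * s) = 1 - 2 * (sin s)\<^sup>2\<close>.\<close>
      define s where "s = pi * real k / real (n + 1)"
      have "s < pi" using k by (simp add: s_def divide_less_eq del: of_nat_add of_nat_Suc)
      moreover have "0 < s" using k by (simp add: s_def)
      ultimately have "sin s > 0" by (simp add: sin_gt_zero)
      moreover have "Re (polygon_vertex n k) = 1 - 2 * (sin s)\<^sup>2"
        by (simp add: polygon_vertex_def s_def mult.assoc flip: cos_double_sin)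
      ultimately show "Re (polygon_vertex n k) < 1" by simp
    qed
    show "convex {z. Re z < 1}"
      using convex_halfspace_lt[of "1::complex" 1] by (simp add: inner_complex_def)
  qed
  then show ?thesis by (auto simp: polygon_vertex_def)
qed

lemma triangulation_poset_le_triangle:
  assumes "J \<in> triangulation_poset n \<T>"
  obtains T where "T \<in> \<T>" "J \<subseteq> T"
  using assms by (auto simp: triangulation_poset_def diagonals_def)

lemma triangulation_poset_le_vertices:
  assumes "polygon_triangulation n \<T>" "J \<in> triangulation_poset n \<T>"
  shows "J \<subseteq> {..n}"
proof -
  obtain T where "T \<in> \<T>" "J \<subseteq> T" using assms(2) by (rule triangulation_poset_le_triangle)
  moreover have "T \<subseteq> {..n}" using assms(1) \<open>T \<in> \<T>\<close> by (simp add: polygon_triangulation_def)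
  ultimately show ?thesis by blast
qed

text \<open>The chords from 0 to \<open>b\<close> and from \<open>i\<close> to \<open>k\<close> meet
  at a point \<open>x\<close> of both triangles. The triangles intersect in a face of
  \<open>T\<close>; a face containing an inner point of a segment of \<open>T\<close> contains its
  ends, so vertex 0 would lie in the triangle \<open>I\<close>.\<close>

lemma triangulation_poset_no_crossing:
  assumes \<T>: "polygon_triangulation n \<T>"
    and I: "I \<in> \<T>" "0 \<notin> I" "i \<in> I" "k \<in> I"
    and J: "J \<in> triangulation_poset n \<T>" "0 \<in> J" "b \<in> J"
    and ibk: "i < b" "b < k"
  shows False
proof -
  obtain T where T: "T \<in> \<T>" "J \<subseteq> T"
    using J(1) by (rule triangulation_poset_le_triangle)
  have sub: "I \<subseteq> {..n}" "T \<subseteq> {..n}" using \<T> I T by (auto simp: polygon_triangulation_def)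
  define a where "a m = 2 * pi * real m / real (n + 1)" for m
  have mono: "a m < a m'" if "m < m'" for m m'
    using that by (simp add: a_def divide_strict_right_mono)
  have "0 < i" using I by (auto intro: gr0I)
  moreover have "k \<le> n" using sub I by auto
  then have "a k < 2 * pi" by (simp add: a_def divide_less_eq)
  ultimately obtain x where x: "x \<in> open_segment 1 (cis (a b))" "x \<in> closed_segment (cis (a i)) (cis (a k))"
    using chords_cross[of "a i" "a b" "a k"] ibk mono[of 0 i] mono[of i b] mono[of b k]
    by (auto simp: a_def)
  have v: "polygon_vertex n m = cis (a m)" for m by (simp add: polygon_vertex_def a_def)
  have v0: "1 = polygon_vertex n 0" by (simp add: polygon_vertex_def)
  have "closed_segment (cis (a i)) (cis (a k)) \<subseteq> polygon_hull n I"
    unfolding polygon_hull_def segment_convex_hull using I v by (intro hull_mono) auto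
  then have xI: "x \<in> polygon_hull n I" using x by auto
  have in_T: "polygon_vertex n 0 \<in> polygon_hull n T" "polygon_vertex n b \<in> polygon_hull n T"
    unfolding polygon_hull_def using T J by (auto intro!: hull_inc)
  then have "x \<in> polygon_hull n T"
    using x closed_segment_subset[of _ "polygon_hull n T"]
    by (auto simp: v0 v[symmetric] open_segment_def polygon_hull_def)
  moreover have "polygon_hull n I \<inter> polygon_hull n T face_of polygon_hull n T"
    using \<T> I T unfolding polygon_triangulation_def triangulation_def by (metis Int_commute imageI)
  ultimately have "polygon_vertex n 0 \<in> polygon_hull n I"
    using xI x in_T unfolding face_of_def v0 v[symmetric] by blast
  then show False using polygon_hull_no_zero sub I by blast
qed


section \<open>The 2-Segal map\<close>

theorem proposition7p6:
  fixes n :: nat and \<T> :: "nat set set"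
  assumes "n \<ge> 3"
    and "polygon_triangulation n \<T>"
    and "\<exists>I \<in> \<T>. 0 \<notin> I"
  shows "\<exists>C :: (nat, nat) cof_category. category_with_cofibrations C \<and>
    \<not> weak_homotopy_equivalence
        (Level (iS_space C) {..n})
        (holim (triangulation_poset n \<T>) (iS_space C))
        (two_segal_map n (triangulation_poset n \<T>) (iS_space C))"
proof -
  let ?C = FinPset_op and ?P = "triangulation_poset n \<T>"
  interpret category_with_cofibrations ?C by (rule cofibrations_FinPset_op)
  have Cof: "Cof ?C = Arr ?C" by (simp add: FinPset_op_def)
  \<comment> \<open>A pointed set with one further point is a nonzero object.\<close>
  have "finite {0, 1 :: nat}" "0 \<in> {0, 1 :: nat}" by simp_all
  then obtain a where pset_a: "pset a = {0, 1}" by (rule pset_surj)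
  have "pset a \<noteq> {0}" by (simp add: pset_a doubleton_eq_iff)
  then have a: "a \<in> Obj ?C" "\<not> is_zero_object ?C a"
    unfolding zero_object_FinPset_op by (simp_all only: FinPset_op_def precategory.simps UNIV_I not_False_eq_True)
  obtain I where I: "I \<in> \<T>" "0 \<notin> I" using assms by blast
  then have card: "I \<subseteq> {..n}" "card I = 3" using assms by (auto simp: polygon_triangulation_def)
  then obtain i j k where ijk: "i < j" "j < k" "i \<in> I" "j \<in> I" "k \<in> I"
  proof -
    obtain x y z where "I = {x, y, z}" "x \<noteq> y" "x \<noteq> z" "y \<noteq> z" using card by (auto simp: card_3_iff)
    then show ?thesis using that by (metis insertI1 insertI2 linorder_neqE_nat)
  qed
  have P: "?P \<subseteq> Pow {..n}"
    using triangulation_poset_le_vertices[OF assms(2)] by blast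
  let ?x = "\<lambda>m. vertex (iS ?C {..n}) (step_functor ?C a m {..n})"
  note step = step_functor_iS[OF a(1) Cof]
  have x: "?x m \<in> topspace (Level (iS_space ?C) {..n})" for m
    using vertex_in_realization[OF category_iS[OF category_axioms] step] by (simp add: iS_space_def)
  \<comment> \<open>A difference would need \<open>0, b \<in> J\<close> with
    \<open>i < b \<le> j\<close>; as \<open>j < k\<close>, the chord from 0 to \<open>b\<close>
    would then cross the chord from \<open>i\<close> to \<open>k\<close> of
    \<open>I\<close>.\<close>
  have "step_functor ?C a i J = step_functor ?C a j J" if J: "J \<in> ?P" for J
  proof (rule step_functor_cong)
    fix b assume "0 \<in> J" "b \<in> J" "0 < b"
    then show "b \<le> i \<longleftrightarrow> b \<le> j"
      using triangulation_poset_no_crossing[OF assms(2) I ijk(3,5) J] ijk(1,2)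
      by (meson leD le_less_trans le_trans less_imp_le not_le_imp_less)
  qed
  \<comment> \<open>All restrictions agree on the nose, hence so do the points and the constant
    paths between them.\<close>
  then have "two_segal_map n ?P (iS_space ?C) (?x i) = two_segal_map n ?P (iS_space ?C) (?x j)"
    using P unfolding two_segal_map_vertex[OF category_axioms P step]
    by (auto simp: restrict_step_functor strict_pairs_def subset_iff intro!: restrict_ext)
  moreover have "\<not> path_component_of (Level (iS_space ?C) {..n}) (?x i) (?x j)"
    using step_functors_not_connected[OF cofibrations_FinPset_op a(2) _ _ ijk(1)] ijk card
    by (auto simp: iS_space_def)
  ultimately have "\<not> weak_homotopy_equivalence (Level (iS_space ?C) {..n}) (holim ?P (iS_space ?C))
      (two_segal_map n ?P (iS_space ?C))"
    using not_weak_homotopy_equivalence[OF x x]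
      two_segal_map_vertex_in_holim[OF category_axioms P step] by blast
  then show ?thesis using cofibrations_FinPset_op by blast
qed

end
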